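(* Let $\Omega=\{z\in\mathbb{C}^n:\rho_1(z)<0,\dots,\rho_N(z)<0\}$ be a convex normal polyhedral domain in $\mathbb{C}^n$. Let $q\in\partial_{\alpha_1\cdots\alpha_n}\Omega$ for some distinct indices $\alpha_1,\dots,\alpha_n$. Then the maximal circularity function satisfies $c_\Omega(x)\to1$ as $x\to q$ (with $x\in\Omega$).
   Context: A bounded domain $\Omega\subset\mathbb{C}^n$ is a polyhedral domain if there are smooth real-valued functions $\rho_1,\dots,\rho_N$ defined on a neighborhood of $\overline\Omega$ such that: $\Omega=\{z\in\mathbb{C}^n:\rho_1(z)<0,\dots,\rho_N(z)<0\}$; for each $\alpha=1,\dots,N$, $\nabla\rho_\alpha$ never vanishes on $\partial_\alpha\Omega:=\{z\in\partial\Omega:\rho_\alpha(z)=0\}$; and each $\partial_\alpha\Omega$ is Levi flat. It is normal if in addition, on each $\partial_{\alpha_1\cdots\alpha_k}\Omega:=\{z\in\partial\Omega:\rho_{\alpha_1}(z)=\cdots=\rho_{\alpha_k}(z)=0\}$ (distinct indices), the gradients $\nabla\rho_{\alpha_1},\dots,\nabla\rho_{\alpha_k}$, regarded as vectors in $\mathbb{C}^n$, are linearly independent over $\mathbb{C}$. The Kobayashi-Royden metric of a domain $D\subset\mathbb{C}^n$ is $K_D(x;v)=\inf\{\lambda>0:\exists f\in\mathcal{O}(\Delta,D),\ f(0)=x,\ \lambda f'(0)=v\}$, where $\mathcal{O}(\Delta,D)$ is the set of holomorphic maps from the unit disc $\Delta\subset\mathbb{C}$ into $D$; its indicatrix at $x$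 is $I_D(x)=\{v\in\mathbb{C}^n:K_D(x;v)<1\}$. For a bounded domain $\Omega$ and $x\in\Omega$, $\mathcal{B}_\Omega(x)$ denotes the class of bounded holomorphic embeddings $\varphi:\Omega\to\mathbb{C}^n$ (injective holomorphic maps with bounded image) with $\varphi(x)=0$. The maximal circularity function is $$c_\Omega(x)=\sup\Big\{\frac{r}{R}:\exists\,\varphi\in\mathcal{B}_\Omega(x),\ R>0,\ r>0\text{ such that } r\,I_{\varphi(\Omega)}(0)\subset\varphi(\Omega)\subset R\,I_{\varphi(\Omega)}(0)\Big\}.$$ *)

theory Defs
  imports "HOL-Analysis.Analysis"
begin

section \<open>Smooth functions and complex derivatives\<close>

primrec k_times_differentiable_on ::
    "nat \<Rightarrow> ('a::real_normed_vector \<Rightarrow> 'b::real_normed_vector) \<Rightarrow> 'a set \<Rightarrow> bool" where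
  "k_times_differentiable_on 0 f U \<longleftrightarrow> continuous_on U f"
| "k_times_differentiable_on (Suc k) f U \<longleftrightarrow>
     (\<forall>z\<in>U. f differentiable at z) \<and>
     (\<forall>v. k_times_differentiable_on k (\<lambda>z. frechet_derivative f (at z) v) U)"

text \<open>Only used on open \<open>U\<close>, where it is the class of infinitely differentiable functions: all
  iterated directional derivatives exist and are continuous.\<close>
definition smooth_on :: "('a::real_normed_vector \<Rightarrow> 'b::real_normed_vector) \<Rightarrow> 'a set \<Rightarrow> bool" where
  "smooth_on f U \<longleftrightarrow> (\<forall>k. k_times_differentiable_on k f U)"

text \<open>The gradient for the real inner product of the Euclidean space \<open>'a\<close>. For
  \<open>'a = complex ^ 'n\<close> its components are \<open>\<partial>f/\<partial>x\<^sub>j + \<i> \<partial>f/\<partial>y\<^sub>j\<close>, i.e.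
  it is the real gradient regarded as a complex vector.\<close>
definition gradient :: "('a::real_inner \<Rightarrow> real) \<Rightarrow> 'a \<Rightarrow> 'a" where
  "gradient f z = (THE D. GDERIV f z :> D)"

text \<open>The Wirtinger derivatives
  \<open>\<partial>/\<partial>z\<^sub>j = (\<partial>/\<partial>x\<^sub>j - \<i> \<partial>/\<partial>y\<^sub>j) / 2\<close> and
  \<open>\<partial>/\<partial>zbar\<^sub>j = (\<partial>/\<partial>x\<^sub>j + \<i> \<partial>/\<partial>y\<^sub>j) / 2\<close>.\<close>
definition wirtinger :: "'n \<Rightarrow> (complex ^ 'n::finite \<Rightarrow> complex) \<Rightarrow> complex ^ 'n \<Rightarrow> complex" where
  "wirtinger j f z = (frechet_derivative f (at z) (axis j 1)
                        - \<i> * frechet_derivative f (at z) (axis j \<i>)) / 2"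

definition wirtinger_bar :: "'n \<Rightarrow> (complex ^ 'n::finite \<Rightarrow> complex) \<Rightarrow> complex ^ 'n \<Rightarrow> complex" where
  "wirtinger_bar j f z = (frechet_derivative f (at z) (axis j 1)
                            + \<i> * frechet_derivative f (at z) (axis j \<i>)) / 2"

definition holomorphic_map_on ::
    "(complex ^ 'n::finite \<Rightarrow> complex ^ 'm::finite) \<Rightarrow> (complex ^ 'n) set \<Rightarrow> bool" where
  "holomorphic_map_on f S \<longleftrightarrow>
     (\<forall>z\<in>S. \<exists>A :: complex ^ 'n ^ 'm. (f has_derivative (\<lambda>h. A *v h)) (at z within S))"


section \<open>Polyhedral domains\<close>

definition levi_form :: "(complex ^ 'n::finite \<Rightarrow> real) \<Rightarrow> complex ^ 'n \<Rightarrow> complex ^ 'n \<Rightarrow> complex" where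
  "levi_form \<rho> z v =
     (\<Sum>j\<in>UNIV. \<Sum>k\<in>UNIV.
        wirtinger j (wirtinger_bar k (\<lambda>w. complex_of_real (\<rho> w))) z * (v $ j) * cnj (v $ k))"

text \<open>\<open>S\<close> is a piece of a hypersurface with defining function \<open>\<rho>\<close>; the condition on
  \<open>v\<close> says that \<open>v\<close> lies in the complex tangent space of \<open>{\<rho> = 0}\<close> at \<open>z\<close>.\<close>
definition levi_flat :: "(complex ^ 'n::finite \<Rightarrow> real) \<Rightarrow> (complex ^ 'n) set \<Rightarrow> bool" where
  "levi_flat \<rho> S \<longleftrightarrow>
     (\<forall>z\<in>S. \<forall>v. (\<Sum>j\<in>UNIV. wirtinger j (\<lambda>w. complex_of_real (\<rho> w)) z * (v $ j)) = 0
        \<longrightarrow> levi_form \<rho> z v = 0)"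

text \<open>\<open>face \<rho> \<Omega> {\<alpha>\<^sub>1, \<dots>, \<alpha>\<^sub>k}\<close> is
  \<open>\<partial>\<^bsub>\<alpha>\<^sub>1\<dots>\<alpha>\<^sub>k\<^esub> \<Omega>\<close>; it depends only on the set of the (distinct) indices.\<close>
definition face :: "(nat \<Rightarrow> complex ^ 'n::finite \<Rightarrow> real) \<Rightarrow> (complex ^ 'n) set \<Rightarrow> nat set
    \<Rightarrow> (complex ^ 'n) set" where
  "face \<rho> \<Omega> A = {z \<in> frontier \<Omega>. \<forall>\<alpha>\<in>A. \<rho> \<alpha> z = 0}"

text \<open>The functions \<open>\<rho> \<alpha>\<close> are meaningful only on the neighbourhood \<open>U\<close> of the closure.\<close>
definition polyhedral_domain ::
    "nat \<Rightarrow> (nat \<Rightarrow> complex ^ 'n::finite \<Rightarrow> real) \<Rightarrow> (complex ^ 'n) set \<Rightarrow> bool" where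
  "polyhedral_domain N \<rho> \<Omega> \<longleftrightarrow>
     open \<Omega> \<and> connected \<Omega> \<and> \<Omega> \<noteq> {} \<and> bounded \<Omega> \<and>
     (\<exists>U. open U \<and> closure \<Omega> \<subseteq> U \<and>
        (\<forall>\<alpha>\<in>{1..N}. smooth_on (\<rho> \<alpha>) U) \<and>
        \<Omega> = {z \<in> U. \<forall>\<alpha>\<in>{1..N}. \<rho> \<alpha> z < 0}) \<and>
     (\<forall>\<alpha>\<in>{1..N}. \<forall>z\<in>face \<rho> \<Omega> {\<alpha>}. gradient (\<rho> \<alpha>) z \<noteq> 0) \<and>
     (\<forall>\<alpha>\<in>{1..N}. levi_flat (\<rho> \<alpha>) (face \<rho> \<Omega> {\<alpha>}))"

text \<open>\<open>vec.independent\<close> is linear independence over the scalar field \<open>complex\<close>; together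
  with injectivity it says that the family of gradients indexed by \<open>A\<close> is independent.\<close>
definition normal_polyhedral_domain ::
    "nat \<Rightarrow> (nat \<Rightarrow> complex ^ 'n::finite \<Rightarrow> real) \<Rightarrow> (complex ^ 'n) set \<Rightarrow> bool" where
  "normal_polyhedral_domain N \<rho> \<Omega> \<longleftrightarrow>
     polyhedral_domain N \<rho> \<Omega> \<and>
     (\<forall>A. A \<noteq> {} \<and> A \<subseteq> {1..N} \<longrightarrow>
        (\<forall>z\<in>face \<rho> \<Omega> A.
           inj_on (\<lambda>\<alpha>. gradient (\<rho> \<alpha>) z) A \<and>
           vec.independent ((\<lambda>\<alpha>. gradient (\<rho> \<alpha>) z) ` A)))"


section \<open>The Kobayashi--Royden metric and the maximal circularity function\<close>

definition holomorphic_discs :: "(complex ^ 'n::finite) set \<Rightarrow> (complex \<Rightarrow> complex ^ 'n) set" where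
  "holomorphic_discs D =
     {f. (\<forall>i. (\<lambda>\<zeta>. f \<zeta> $ i) holomorphic_on ball 0 1) \<and> f ` ball 0 1 \<subseteq> D}"

text \<open>For open \<open>D\<close> and \<open>x \<in> D\<close> the set below is nonempty, so the infimum is a proper one.\<close>
definition kobayashi_royden :: "(complex ^ 'n::finite) set \<Rightarrow> complex ^ 'n \<Rightarrow> complex ^ 'n \<Rightarrow> real" where
  "kobayashi_royden D x v =
     Inf {l :: real. l > 0 \<and>
       (\<exists>f\<in>holomorphic_discs D. f 0 = x \<and> l *\<^sub>R (\<chi> i. deriv (\<lambda>\<zeta>. f \<zeta> $ i) 0) = v)}"

definition indicatrix :: "(complex ^ 'n::finite) set \<Rightarrow> complex ^ 'n \<Rightarrow> (complex ^ 'n) set" where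
  "indicatrix D x = {v. kobayashi_royden D x v < 1}"

definition bounded_embeddings ::
    "(complex ^ 'n::finite) set \<Rightarrow> complex ^ 'n \<Rightarrow> (complex ^ 'n \<Rightarrow> complex ^ 'n) set" where
  "bounded_embeddings \<Omega> x =
     {\<phi>. holomorphic_map_on \<phi> \<Omega> \<and> inj_on \<phi> \<Omega> \<and> bounded (\<phi> ` \<Omega>) \<and> \<phi> x = 0}"

text \<open>For a bounded domain \<open>\<Omega>\<close> and \<open>x \<in> \<Omega>\<close> the set of ratios is nonempty (use
  translations) and bounded above by 1, so the supremum is a proper one.\<close>
definition maximal_circularity :: "(complex ^ 'n::finite) set \<Rightarrow> complex ^ 'n \<Rightarrow> real" where
  "maximal_circularity \<Omega> x =
     Sup {r / R | r R. r > 0 \<and> R > 0 \<and>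
       (\<exists>\<phi>\<in>bounded_embeddings \<Omega> x.
          (\<lambda>v. r *\<^sub>R v) ` indicatrix (\<phi> ` \<Omega>) 0 \<subseteq> \<phi> ` \<Omega> \<and>
          \<phi> ` \<Omega> \<subseteq> (\<lambda>v. R *\<^sub>R v) ` indicatrix (\<phi> ` \<Omega>) 0)}"

end

theory Submission
  imports Defs "HOL-Complex_Analysis.Conformal_Mappings"
begin

text \<open>If an embedding \<open>\<phi>\<close> maps \<open>\<Omega>\<close> into the unit polydisc and onto a set containing the polydisc of
  radius \<open>r\<close>, then by the Schwarz lemma the indicatrix of \<open>\<phi>(\<Omega>)\<close> at \<open>0\<close> lies between the same two
  polydiscs, and the circularity is at least \<open>r\<^sup>2\<close>. Near the corner \<open>q\<close> such embeddings exist because the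
  normals of each smooth face are, up to complex factors, constant: convexity makes the Hessian of a
  defining function semidefinite on the tangent space, Levi flatness then puts the complex tangent
  space into its kernel, and so the gradient moves only within its own complex line. The functionals
  dual to the \<open>n\<close> gradients at \<open>q\<close> thus serve as linear coordinates in which every boundary point near
  \<open>q\<close> has a supporting half space in one coordinate \<open>w\<^sub>j\<close> alone, with normal close to \<open>1\<close>. Leaving \<open>\<Omega>\<close> from
  \<open>x\<close> along each coordinate direction gives one such half plane per coordinate; the product of the
  Cayley transforms of these half planes centred at \<open>x\<close> is the required embedding. The preimage of the
  polydisc of radius \<open>r\<close> stays in \<open>\<Omega>\<close>, since a boundary point between it and \<open>x\<close> would yield a second
  half plane with almost the same normal that separates it from the first exit point.\<close>

section \<open>Indicatrices of domains between two polydiscs\<close>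

abbreviation polydisc :: "real \<Rightarrow> (complex ^ 'n::finite) set" where
  "polydisc r \<equiv> {w. \<forall>i. cmod (w $ i) < r}"

text \<open>The discs \<open>\<zeta> \<mapsto> s \<zeta> v\<close> are the competitors used for
  upper bounds of the Kobayashi metric at 0; such a disc contributes the value \<open>1 / s\<close>
  to the infimum.\<close>

lemma linear_disc:
  fixes D :: "(complex ^ 'n::finite) set"
  assumes "polydisc \<epsilon> \<subseteq> D" and "s > 0" and "\<And>i. s * cmod (v $ i) < \<epsilon>"
  shows "\<exists>f\<in>holomorphic_discs D. f 0 = 0 \<and> (1 / s) *\<^sub>R (\<chi> i. deriv (\<lambda>\<zeta>. f \<zeta> $ i) 0) = v"
proof
  define f where "f = (\<lambda>\<zeta>::complex. \<chi> i. \<zeta> * (of_real s * v $ i))"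
  have "deriv (\<lambda>\<zeta>. f \<zeta> $ i) 0 = of_real s * v $ i" for i
    unfolding f_def by (intro DERIV_imp_deriv) (auto intro!: derivative_eq_intros)
  then show "f 0 = 0 \<and> (1 / s) *\<^sub>R (\<chi> i. deriv (\<lambda>\<zeta>. f \<zeta> $ i) 0) = v"
    using assms(2) by (simp add: f_def vec_eq_iff) (simp add: scaleR_conv_of_real)
  have "f \<zeta> \<in> D" if "cmod \<zeta> < 1" for \<zeta>
  proof -
    have "cmod (f \<zeta> $ i) < \<epsilon>" for i
    proof -
      have "cmod (f \<zeta> $ i) = cmod \<zeta> * (s * cmod (v $ i))"
        using assms(2) by (simp add: f_def norm_mult)
      also have "\<dots> \<le> 1 * (s * cmod (v $ i))"
        using that assms(2) by (intro mult_right_mono) auto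
      finally show ?thesis using assms(3)[of i] by simp
    qed
    then show ?thesis using assms(1) by blast
  qed
  then show "f \<in> holomorphic_discs D"
    by (auto simp: holomorphic_discs_def f_def intro!: holomorphic_intros)
qed

lemma kobayashi_royden_le:
  fixes D :: "(complex ^ 'n::finite) set"
  assumes "l > 0" and "f \<in> holomorphic_discs D" and "f 0 = x"
    and "l *\<^sub>R (\<chi> i. deriv (\<lambda>\<zeta>. f \<zeta> $ i) 0) = v"
  shows "kobayashi_royden D x v \<le> l"
  unfolding kobayashi_royden_def
  by (rule cInf_lower) (use assms in \<open>auto intro!: bdd_belowI[of _ 0]\<close>)

text \<open>Membership in the indicatrix is a strict inequality, so the linear disc along
  \<open>v\<close> must be stretched by a factor above 1. Finiteness of the index type leaves a gap
  between the largest coordinate and \<open>\<epsilon>\<close>.\<close>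

lemma polydisc_subset_indicatrix:
  fixes D :: "(complex ^ 'n::finite) set"
  assumes "polydisc \<epsilon> \<subseteq> D" and "\<epsilon> > 0"
  shows "polydisc \<epsilon> \<subseteq> indicatrix D 0"
proof clarify
  fix v :: "complex ^ 'n" assume v: "\<forall>i. cmod (v $ i) < \<epsilon>"
  define m where "m = Max (range (\<lambda>i. cmod (v $ i)))"
  have m: "cmod (v $ i) \<le> m" for i unfolding m_def by (rule Max_ge) auto
  have "m < \<epsilon>" unfolding m_def by (subst Max_less_iff) (use v in auto)
  moreover have "0 \<le> m" using m[of undefined] norm_ge_zero order_trans by blast
  \<comment> \<open>The witness for \<open>s\<close>: it exceeds 1 because
    \<open>m < \<epsilon>\<close>, and \<open>s * m < \<epsilon>\<close> because
    \<open>2 * m < \<epsilon> + m\<close>.\<close>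
  ultimately have "2 * \<epsilon> / (\<epsilon> + m) > 1" "2 * \<epsilon> / (\<epsilon> + m) * m < \<epsilon>"
    using assms(2) by (auto simp: field_simps)
  then obtain s where s: "s > 1" "s * m < \<epsilon>" by blast
  then have "s > 0" by simp
  have "s * cmod (v $ i) < \<epsilon>" for i
    using mult_left_mono[OF m[of i], of s] s by linarith
  from linear_disc[OF assms(1) \<open>s > 0\<close> this] obtain f
    where "f \<in> holomorphic_discs D" "f 0 = 0" "(1 / s) *\<^sub>R (\<chi> i. deriv (\<lambda>\<zeta>. f \<zeta> $ i) 0) = v"
    by blast
  then have "kobayashi_royden D 0 v \<le> 1 / s"
    using s(1) by (intro kobayashi_royden_le) auto
  then show "v \<in> indicatrix D 0"
    using s(1) by (simp add: indicatrix_def) (smt (verit) divide_less_eq_1)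
qed

text \<open>The Schwarz lemma, applied to each coordinate of a disc divided by \<open>M\<close>,
  bounds the derivative at 0 by \<open>M\<close>; the scaling factor \<open>l < 1\<close> makes the
  bound strict.\<close>

lemma indicatrix_subset_polydisc:
  fixes D :: "(complex ^ 'n::finite) set"
  assumes "polydisc \<epsilon> \<subseteq> D" and "\<epsilon> > 0" and "D \<subseteq> polydisc M"
  shows "indicatrix D 0 \<subseteq> polydisc M"
proof clarify
  fix v i assume "v \<in> indicatrix D 0"
  have "(\<chi> i. 0) \<in> D" using assms(1,2) by auto
  then have "M > 0" using assms(3) by auto
  let ?S = "{l :: real. l > 0 \<and>
       (\<exists>f\<in>holomorphic_discs D. f 0 = 0 \<and> l *\<^sub>R (\<chi> i. deriv (\<lambda>\<zeta>. f \<zeta> $ i) 0) = v)}"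
  \<comment> \<open>A linear disc small enough to stay in \<open>D\<close> shows that
    \<open>?S\<close> is nonempty, so that \<open>Inf ?S < 1\<close> yields an element below
    1.\<close>
  have "norm v + 1 > 0" by (smt (verit) norm_ge_zero)
  then have pos: "\<epsilon> / (norm v + 1) > 0" using assms(2) by simp
  have "\<epsilon> / (norm v + 1) * cmod (v $ i) < \<epsilon>" for i
  proof -
    have "cmod (v $ i) < norm v + 1"
      using Finite_Cartesian_Product.norm_nth_le[of v i] by simp
    then have "\<epsilon> * cmod (v $ i) < \<epsilon> * (norm v + 1)"
      using assms(2) by (rule mult_strict_left_mono)
    then show ?thesis using \<open>norm v + 1 > 0\<close> by (simp add: pos_divide_less_eq)
  qed
  from linear_disc[OF assms(1) pos this] have "1 / (\<epsilon> / (norm v + 1)) \<in> ?S"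
    using zero_less_divide_1_iff[THEN iffD2, OF pos] by blast
  then have "?S \<noteq> {}" by blast
  moreover have "Inf ?S < 1"
    using \<open>v \<in> indicatrix D 0\<close> by (simp add: indicatrix_def kobayashi_royden_def)
  ultimately obtain l where "l \<in> ?S" "l < 1"
    by (metis (no_types, lifting) cInf_lessD)
  then obtain f where f: "f \<in> holomorphic_discs D" and l: "0 < l" "l < 1"
    and v: "l *\<^sub>R (\<chi> i. deriv (\<lambda>\<zeta>. f \<zeta> $ i) 0) = v" and f0: "f 0 = 0" by auto
  define g where "g = (\<lambda>\<zeta>. f \<zeta> $ i / of_real M)"
  have hol: "(\<lambda>\<zeta>. f \<zeta> $ i) holomorphic_on ball 0 1"
    using f by (simp add: holomorphic_discs_def)
  have "cmod (deriv g 0) \<le> 1"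
  proof (rule Schwarz_Lemma(2)[where \<xi> = 0])
    show "g holomorphic_on ball 0 1"
      unfolding g_def using hol \<open>M > 0\<close> by (intro holomorphic_intros) auto
    show "g 0 = 0" using f0 by (simp add: g_def)
    show "cmod (g z) < 1" if "cmod z < 1" for z
    proof -
      have "f z \<in> D" using f that by (auto simp: holomorphic_discs_def)
      then show ?thesis using assms(3) \<open>M > 0\<close> by (auto simp: g_def norm_divide)
    qed
  qed simp
  moreover have "deriv g 0 = deriv (\<lambda>\<zeta>. f \<zeta> $ i) 0 / of_real M"
    unfolding g_def by (intro deriv_cdivide_right holomorphic_on_imp_differentiable_at[OF hol]) auto
  ultimately have "cmod (deriv (\<lambda>\<zeta>. f \<zeta> $ i) 0) \<le> M"
    using \<open>M > 0\<close> by (simp add: norm_divide)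
  then have "l * cmod (deriv (\<lambda>\<zeta>. f \<zeta> $ i) 0) \<le> l * M"
    using l by (intro mult_left_mono) auto
  also have "\<dots> < M" using l \<open>M > 0\<close> by simp
  finally show "cmod (v $ i) < M" using l(1) unfolding v[symmetric] by simp
qed

section \<open>Bounds for the circularity function\<close>

lemma open_contains_polydisc:
  fixes D :: "(complex ^ 'n::finite) set"
  assumes "open D" and "0 \<in> D"
  obtains \<epsilon> where "\<epsilon> > 0" and "polydisc \<epsilon> \<subseteq> D"
proof -
  obtain e where e: "e > 0" "ball 0 e \<subseteq> D" using assms open_contains_ball by blast
  let ?\<epsilon> = "e / CARD('n)"
  show thesis
  proof
    show "?\<epsilon> > 0" using e by simp
    show "polydisc ?\<epsilon> \<subseteq> D"
    proof clarify
      fix w :: "complex ^ 'n" assume w: "\<forall>i. cmod (w $ i) < ?\<epsilon>"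
      have "norm w \<le> (\<Sum>i\<in>UNIV. cmod (w $ i))"
        unfolding norm_vec_def by (intro L2_set_le_sum) auto
      also have "\<dots> < (\<Sum>i\<in>(UNIV::'n set). ?\<epsilon>)" using w by (intro sum_strict_mono) auto
      finally show "w \<in> D" using e by auto
    qed
  qed
qed

text \<open>A ratio \<open>t > 1\<close> would make the indicatrix stable under dilation by
  \<open>t\<close>, although it is bounded and contains nonzero vectors.\<close>

lemma circularity_ratio_le_1:
  fixes \<Omega> :: "(complex ^ 'n::finite) set"
  assumes "open \<Omega>" and "x \<in> \<Omega>" and "\<phi> \<in> bounded_embeddings \<Omega> x" and "r > 0" and "R > 0"
    and "(\<lambda>v. r *\<^sub>R v) ` indicatrix (\<phi> ` \<Omega>) 0 \<subseteq> \<phi> ` \<Omega>"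
    and "\<phi> ` \<Omega> \<subseteq> (\<lambda>v. R *\<^sub>R v) ` indicatrix (\<phi> ` \<Omega>) 0"
  shows "r / R \<le> 1"
proof (rule ccontr)
  assume "\<not> r / R \<le> 1"
  define t where "t = r / R"
  define I where "I = indicatrix (\<phi> ` \<Omega>) 0"
  have "t > 1" using \<open>\<not> r / R \<le> 1\<close> by (simp add: t_def)
  have \<phi>: "holomorphic_map_on \<phi> \<Omega>" "inj_on \<phi> \<Omega>" "bounded (\<phi> ` \<Omega>)" "\<phi> x = 0"
    using assms(3) by (auto simp: bounded_embeddings_def)
  have "continuous_on \<Omega> \<phi>"
    using \<phi>(1) unfolding holomorphic_map_on_def
    by (meson continuous_on_eq_continuous_within has_derivative_continuous)
  then have "open (\<phi> ` \<Omega>)" using assms(1) \<phi>(2) by (rule invariance_of_domain)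
  moreover have 0: "0 \<in> \<phi> ` \<Omega>" using assms(2) \<phi>(4) by force
  ultimately obtain \<epsilon> where \<epsilon>: "\<epsilon> > 0" "polydisc \<epsilon> \<subseteq> \<phi> ` \<Omega>" by (rule open_contains_polydisc)
  obtain M where "\<phi> ` \<Omega> \<subseteq> ball 0 M" using \<phi>(3) bounded_subset_ballD by blast
  moreover have "ball 0 M \<subseteq> polydisc M" by (auto intro: le_less_trans[OF Finite_Cartesian_Product.norm_nth_le])
  ultimately have "\<phi> ` \<Omega> \<subseteq> polydisc M" by blast
  then have I_bdd: "I \<subseteq> polydisc M" unfolding I_def by (rule indicatrix_subset_polydisc[OF \<epsilon>(2,1)])
  have step: "t *\<^sub>R v \<in> I" if "v \<in> I" for v
  proof -
    have "r *\<^sub>R v \<in> (\<lambda>v. R *\<^sub>R v) ` I" using assms(6,7) that unfolding I_def by blast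
    then obtain u where "r *\<^sub>R v = R *\<^sub>R u" "u \<in> I" by blast
    moreover have "t *\<^sub>R v = (1 / R) *\<^sub>R (r *\<^sub>R v)" by (simp add: t_def)
    ultimately show ?thesis using assms(5) by simp
  qed
  \<comment> \<open>All coordinates are nonzero, so any single one exceeds \<open>M\<close> after
    enough dilations.\<close>
  define v :: "complex ^ 'n" where "v = (\<chi> i. of_real (\<epsilon> / 2))"
  have "v \<in> polydisc \<epsilon>" using \<epsilon>(1) by (simp add: v_def)
  then have "v \<in> I" unfolding I_def using polydisc_subset_indicatrix[OF \<epsilon>(2,1)] by blast
  then have iter: "t ^ k *\<^sub>R v \<in> I" for k
    by (induction k) (use step in \<open>auto simp flip: scaleR_scaleR\<close>)
  obtain k where "M / (\<epsilon> / 2) < t ^ k" using real_arch_pow[OF \<open>t > 1\<close>] by blast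
  then have "M < t ^ k * (\<epsilon> / 2)" using \<epsilon>(1) by (simp add: field_simps)
  moreover have "cmod ((t ^ k *\<^sub>R v) $ i) < M" for i using iter[of k] I_bdd by blast
  ultimately show False using \<epsilon>(1) \<open>t > 1\<close> by (simp add: v_def norm_mult abs_mult)
qed

text \<open>The indicatrix lies between the same two polydiscs as the image, so \<open>r\<close> and
  \<open>R = 1 / r\<close> form an admissible pair; their ratio is the square of
  \<open>r\<close>.\<close>

lemma maximal_circularity_bounds:
  fixes \<Omega> :: "(complex ^ 'n::finite) set"
  assumes "open \<Omega>" and "x \<in> \<Omega>" and "r > 0" and "\<phi> \<in> bounded_embeddings \<Omega> x"
    and "polydisc r \<subseteq> \<phi> ` \<Omega>" and "\<phi> ` \<Omega> \<subseteq> polydisc 1"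
  shows "r\<^sup>2 \<le> maximal_circularity \<Omega> x" and "maximal_circularity \<Omega> x \<le> 1"
proof -
  let ?S = "{r / R | r R. r > 0 \<and> R > 0 \<and>
       (\<exists>\<phi>\<in>bounded_embeddings \<Omega> x.
          (\<lambda>v. r *\<^sub>R v) ` indicatrix (\<phi> ` \<Omega>) 0 \<subseteq> \<phi> ` \<Omega> \<and>
          \<phi> ` \<Omega> \<subseteq> (\<lambda>v. R *\<^sub>R v) ` indicatrix (\<phi> ` \<Omega>) 0)}"
  have le: "s \<le> 1" if "s \<in> ?S" for s
  proof -
    from that obtain r R \<psi> where "s = r / R" "r > 0" "R > 0" "\<psi> \<in> bounded_embeddings \<Omega> x"
      "(\<lambda>v. r *\<^sub>R v) ` indicatrix (\<psi> ` \<Omega>) 0 \<subseteq> \<psi> ` \<Omega>"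
      "\<psi> ` \<Omega> \<subseteq> (\<lambda>v. R *\<^sub>R v) ` indicatrix (\<psi> ` \<Omega>) 0" by blast
    then show ?thesis using circularity_ratio_le_1[OF assms(1,2)] by metis
  qed
  have I: "polydisc r \<subseteq> indicatrix (\<phi> ` \<Omega>) 0" "indicatrix (\<phi> ` \<Omega>) 0 \<subseteq> polydisc 1"
    by (rule polydisc_subset_indicatrix[OF assms(5,3)])
      (rule indicatrix_subset_polydisc[OF assms(5,3,6)])
  have 1: "(\<lambda>v. r *\<^sub>R v) ` indicatrix (\<phi> ` \<Omega>) 0 \<subseteq> \<phi> ` \<Omega>"
  proof clarify
    fix v assume "v \<in> indicatrix (\<phi> ` \<Omega>) 0"
    then have "r *\<^sub>R v \<in> polydisc r" using I(2) assms(3) by auto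
    then show "r *\<^sub>R v \<in> \<phi> ` \<Omega>" using assms(5) by blast
  qed
  have 2: "\<phi> ` \<Omega> \<subseteq> (\<lambda>v. (1 / r) *\<^sub>R v) ` indicatrix (\<phi> ` \<Omega>) 0"
  proof (rule subsetI)
    fix w assume "w \<in> \<phi> ` \<Omega>"
    then have "r *\<^sub>R w \<in> polydisc r" using assms(3,6) by auto
    then have "r *\<^sub>R w \<in> indicatrix (\<phi> ` \<Omega>) 0" using I(1) by blast
    moreover have "w = (1 / r) *\<^sub>R (r *\<^sub>R w)" using assms(3) by simp
    ultimately show "w \<in> (\<lambda>v. (1 / r) *\<^sub>R v) ` indicatrix (\<phi> ` \<Omega>) 0" by (metis image_eqI)
  qed
  have mem: "r\<^sup>2 \<in> ?S"
    by (rule CollectI, rule exI[of _ r], rule exI[of _ "1 / r"], intro conjI bexI[of _ \<phi>])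
      (use 1 2 assms(3,4) in \<open>simp_all add: power2_eq_square\<close>)
  show "r\<^sup>2 \<le> maximal_circularity \<Omega> x"
    unfolding maximal_circularity_def by (rule cSup_upper[OF mem]) (rule bdd_aboveI, rule le)
  show "maximal_circularity \<Omega> x \<le> 1"
    unfolding maximal_circularity_def
  proof (rule cSup_least)
    show "?S \<noteq> {}" by (rule ex_in_conv[THEN iffD1], rule exI, rule mem)
  qed (rule le)
qed

section \<open>Corners with prescribed normals\<close>

lemma has_derivative_vec:
  fixes f :: "'a::real_normed_vector \<Rightarrow> 'b::euclidean_space ^ 'n::finite"
  assumes "\<And>i. ((\<lambda>x. f x $ i) has_derivative (\<lambda>h. f' h $ i)) F"
  shows "(f has_derivative f') F"
proof -
  have "linear (axis i :: 'b \<Rightarrow> 'b ^ 'n)" for i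
    by (rule linearI) (auto simp: axis_def vec_eq_iff)
  then have "bounded_linear (axis i :: 'b \<Rightarrow> 'b ^ 'n)" for i
    by (simp add: linear_conv_bounded_linear)
  then have "((\<lambda>x. \<Sum>i\<in>UNIV. axis i (f x $ i)) has_derivative (\<lambda>h. \<Sum>i\<in>UNIV. axis i (f' h $ i))) F"
    by (rule has_derivative_sum[OF bounded_linear.has_derivative[OF _ assms]])
  moreover have "(\<Sum>i\<in>UNIV. axis i (v $ i)) = v" for v :: "'b ^ 'n"
    by (simp add: vec_eq_iff axis_def)
  ultimately show ?thesis by simp
qed

text \<open>\<open>(1 + \<omega>) / (1 - \<omega>)\<close> maps the disc to the right half plane,
  and \<open>2 * \<omega> / (1 - \<omega>)\<close> is this value minus 1. The bounds come from
  \<open>1 - r \<le> cmod (1 - \<omega>) \<le> 2\<close>.\<close>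

lemma Re_Cayley_bound:
  fixes \<omega> :: complex
  assumes "cmod \<omega> < r" and "r < 1"
  shows "cmod (2 * \<omega> / (1 - \<omega>)) \<le> 2 / (1 - r)" and "(1 - r\<^sup>2) / 4 \<le> Re (1 + 2 * \<omega> / (1 - \<omega>))"
proof -
  have "1 - r \<le> 1 - cmod \<omega>" using assms by simp
  also have "\<dots> \<le> cmod (1 - \<omega>)" using norm_triangle_ineq2[of 1 \<omega>] by simp
  finally have le: "1 - r \<le> cmod (1 - \<omega>)" .
  have "2 * cmod \<omega> / cmod (1 - \<omega>) \<le> 2 / (1 - r)"
    using assms le by (intro frac_le) auto
  then show "cmod (2 * \<omega> / (1 - \<omega>)) \<le> 2 / (1 - r)" by (simp add: norm_divide norm_mult)
  have "\<omega> \<noteq> 1" using assms by auto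
  then have "1 + 2 * \<omega> / (1 - \<omega>) = (1 + \<omega>) / (1 - \<omega>)" by (simp add: divide_simps)
  also have "\<dots> = (1 + \<omega>) * cnj (1 - \<omega>) / (cmod (1 - \<omega>))\<^sup>2" by (rule complex_div_cnj)
  also have "Re \<dots> = Re ((1 + \<omega>) * cnj (1 - \<omega>)) / (cmod (1 - \<omega>))\<^sup>2"
    by (simp only: Re_divide_of_real flip: of_real_power)
  also have "Re ((1 + \<omega>) * cnj (1 - \<omega>)) = 1 - (cmod \<omega>)\<^sup>2"
    unfolding cmod_power2 by (simp add: algebra_simps power2_eq_square)
  finally have eq: "Re (1 + 2 * \<omega> / (1 - \<omega>)) = (1 - (cmod \<omega>)\<^sup>2) / (cmod (1 - \<omega>))\<^sup>2" .
  have "cmod (1 - \<omega>) \<le> 2" using norm_triangle_ineq4[of 1 \<omega>] assms by simp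
  then have "(cmod (1 - \<omega>))\<^sup>2 \<le> 2\<^sup>2" by (intro power_mono) auto
  moreover have "(cmod \<omega>)\<^sup>2 \<le> r\<^sup>2" "(cmod \<omega>)\<^sup>2 < 1"
    using assms by (simp_all add: power_mono power_less_one_iff)
  ultimately have "(1 - r\<^sup>2) / 4 \<le> (1 - (cmod \<omega>)\<^sup>2) / (cmod (1 - \<omega>))\<^sup>2"
    using \<open>\<omega> \<noteq> 1\<close> by (intro frac_le) simp_all
  then show "(1 - r\<^sup>2) / 4 \<le> Re (1 + 2 * \<omega> / (1 - \<omega>))" by (simp only: eq)
qed

text \<open>At \<open>c = f = 1\<close> the expression is \<open>1 + u\<close>; the choice of \<open>\<epsilon>\<close> makes the perturbation too small to
  change the sign of its real part.\<close>
lemma Re_near_normals_pos: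
  fixes c f u :: complex
  assumes r: "0 < r" "r < 1" and \<epsilon>: "\<epsilon> = (1 - r)\<^sup>2 / 64"
    and c: "cmod c = 1" "cmod (c - 1) < \<epsilon>" and f: "cmod f = 1" "cmod (f - 1) < \<epsilon>"
    and u: "cmod u \<le> 2 / (1 - r)" "(1 - r\<^sup>2) / 4 \<le> Re (1 + u)"
  shows "Re (cnj f * (of_real (1 / Re c) + c * u)) > 0"
proof -
  have \<epsilon>_small: "0 < \<epsilon>" "\<epsilon> \<le> 1 / 64"
    using r by (auto simp: \<epsilon> power_le_one)
  have \<epsilon>_div: "\<epsilon> / (1 - r) = (1 - r) / 64"
  proof -
    have "a\<^sup>2 / 64 / a = a / 64" if "a \<noteq> 0" for a :: real
      using that by (simp add: power2_eq_square)
    from this[of "1 - r"] show ?thesis using r by (simp only: \<epsilon>)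
  qed
  have "1 - Re c \<le> cmod (c - 1)" using abs_Re_le_cmod[of "c - 1"] by simp
  then have Rec: "Re c > 1 - \<epsilon>" using c by simp
  have "Re c \<le> 1" using complex_Re_le_cmod[of c] c by simp
  have "cmod (of_real (1 / Re c) - 1) = \<bar>1 / Re c - 1\<bar>"
    by (metis norm_of_real of_real_1 of_real_diff)
  also have "\<dots> \<le> 2 * \<epsilon>"
  proof -
    have "(1 - Re c) \<le> 2 * \<epsilon> * Re c"
    proof -
      have "2 * \<epsilon> * Re c \<ge> 2 * \<epsilon> * (1/2)" using Rec \<epsilon>_small by (intro mult_left_mono) auto
      then show ?thesis using Rec by simp
    qed
    then show ?thesis using Rec \<epsilon>_small \<open>Re c \<le> 1\<close> by (simp add: abs_if field_simps)
  qed
  finally have 1: "cmod (of_real (1 / Re c) - 1) \<le> 2 * \<epsilon>" .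
  have cf: "cmod (cnj f - 1) = cmod (f - 1)" by (metis complex_cnj_diff complex_cnj_one complex_mod_cnj)
  have "cmod (cnj f * (of_real (1 / Re c) - 1)) \<le> 2 * \<epsilon>" using 1 f by (simp add: norm_mult)
  then have 2: "cmod (cnj f * (of_real (1 / Re c) - 1) + (cnj f - 1)) \<le> 3 * \<epsilon>"
    using f cf by (intro norm_triangle_le) linarith
  have "cmod (cnj f * (c - 1)) < \<epsilon>" using f c by (simp add: norm_mult)
  then have "cmod (cnj f * (c - 1) + (cnj f - 1)) \<le> 2 * \<epsilon>"
    using f cf by (intro norm_triangle_le) linarith
  then have "cmod ((cnj f * (c - 1) + (cnj f - 1)) * u) \<le> 2 * \<epsilon> * (2 / (1 - r))"
    using u(1) \<epsilon>_small unfolding norm_mult by (intro mult_mono) auto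
  also have "2 * \<epsilon> * (2 / (1 - r)) = (1 - r) / 16" using \<epsilon>_div by (simp add: field_simps)
  finally have 3: "cmod ((cnj f * (c - 1) + (cnj f - 1)) * u) \<le> (1 - r) / 16" .
  have "(1 - r) * (1 + r) \<ge> (1 - r) * 1" using r by (intro mult_left_mono) auto
  moreover have "1 - r\<^sup>2 = (1 - r) * (1 + r)" by (simp add: algebra_simps power2_eq_square)
  ultimately have quarter: "(1 - r\<^sup>2) / 4 \<ge> (1 - r) / 4" by simp
  \<comment> \<open>All that vanishes at \<open>c = f = 1\<close>. Its modulus is at most
    \<open>3 * \<epsilon> + (1 - r) / 16\<close>, hence at most \<open>7 * (1 - r) / 64\<close>,
    which is below the lower bound \<open>(1 - r) / 4\<close> of \<open>Re (1 + u)\<close>.\<close>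
  define e where "e = (cnj f * (of_real (1 / Re c) - 1) + (cnj f - 1)) + (cnj f * (c - 1) + (cnj f - 1)) * u"
  have "cmod e \<le> 3 * \<epsilon> + (1 - r) / 16"
    unfolding e_def using 2 3 by (rule norm_triangle_mono)
  moreover have "3 * \<epsilon> \<le> 3 * ((1 - r) / 64)"
  proof -
    have "(1 - r) * (1 - r) \<le> 1 - r" using r by (intro mult_left_le) auto
    then show ?thesis
      unfolding \<epsilon> power2_eq_square by (intro mult_left_mono divide_right_mono) auto
  qed
  moreover have "- cmod e \<le> Re e" using abs_Re_le_cmod[of e] by linarith
  ultimately have "Re (1 + u) + Re e > 0"
  proof -
    assume e: "cmod e \<le> 3 * \<epsilon> + (1 - r) / 16" "3 * \<epsilon> \<le> 3 * ((1 - r) / 64)" "- cmod e \<le> Re e"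
    have "(1 - r) / 4 \<le> Re (1 + u)" using quarter u(2) by (rule order_trans)
    moreover have "- (3 * ((1 - r) / 64) + (1 - r) / 16) \<le> Re e" using e by linarith
    moreover have "(1 - r) / 4 - (3 * ((1 - r) / 64) + (1 - r) / 16) > 0" using r by simp
    ultimately show ?thesis by linarith
  qed
  moreover have "cnj f * (of_real (1 / Re c) + c * u) = (1 + u) + e"
    by (simp add: e_def algebra_simps)
  ultimately show ?thesis by simp
qed

text \<open>Each component is the Cayley transform of a half plane: \<open>2 t Re(c) c\<close> is the mirror image of \<open>0\<close>
  in the line \<open>Re (cnj c (w - t)) = 0\<close>.\<close>
lemma Cayley_embedding:
  fixes A B :: "complex ^ 'n::finite ^ 'n"
  assumes BA: "B ** A = mat 1"
    and unit: "\<And>j. cmod (c j) = 1" and t: "\<And>j. t j > 0" and c: "\<And>j. Re (c j) > 0"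
    and half: "\<And>j z. z \<in> \<Omega> \<Longrightarrow> Re (cnj (c j) * ((A *v (z - x)) $ j - of_real (t j))) < 0"
  defines "\<phi> \<equiv> \<lambda>z. \<chi> j. (A *v (z - x)) $ j / ((A *v (z - x)) $ j - 2 * of_real (t j * Re (c j)) * c j)"
  shows "\<phi> \<in> bounded_embeddings \<Omega> x" and "\<phi> ` \<Omega> \<subseteq> polydisc 1"
proof -
  define L where "L = (\<lambda>z j. (A *v (z - x)) $ j)"
  define m where "m = (\<lambda>j. 2 * of_real (t j * Re (c j)) * c j)"
  have \<phi>: "\<phi> z $ j = L z j / (L z j - m j)" for z j by (simp add: \<phi>_def L_def m_def)
  have m0: "m j \<noteq> 0" for j using unit[of j] t[of j] c[of j] by (auto simp: m_def)
  have less: "cmod (L z j) < cmod (L z j - m j)" if "z \<in> \<Omega>" for z j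
  proof -
    \<comment> \<open>\<open>d\<close> is the distance from 0 to the line bounding the half plane,
      whose points are those closer to 0 than to its mirror image \<open>m j\<close>.\<close>
    define d where "d = t j * Re (c j)"
    have m: "m j = 2 * of_real d * c j" by (simp add: m_def d_def)
    have cc: "c j * cnj (c j) = 1" using unit[of j] by (simp add: complex_norm_square[symmetric])
    have "Re (cnj (c j) * L z j) < d" using half[OF that, of j] by (simp add: L_def d_def algebra_simps)
    moreover have "d > 0" using t c by (simp add: d_def)
    ultimately have "4 * d * Re (cnj (c j) * L z j) < 4 * d * d" by simp
    moreover have "(cmod (L z j - m j))\<^sup>2 = (cmod (L z j))\<^sup>2 - 4 * d * Re (cnj (c j) * L z j) + 4 * d * d"
    proof -
      have "(cmod (L z j - m j))\<^sup>2 = Re ((L z j - m j) * cnj (L z j - m j))"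
        by (metis Re_complex_of_real complex_norm_square)
      also have "\<dots> = Re (L z j * cnj (L z j)) - 4 * d * Re (cnj (c j) * L z j) + 4 * d * d * Re (c j * cnj (c j))"
        by (simp add: m algebra_simps)
      also have "Re (L z j * cnj (L z j)) = (cmod (L z j))\<^sup>2"
        by (metis Re_complex_of_real complex_norm_square)
      finally show ?thesis using cc by simp
    qed
    ultimately have "(cmod (L z j))\<^sup>2 < (cmod (L z j - m j))\<^sup>2" by linarith
    then show ?thesis by (rule power2_less_imp_less) simp
  qed
  have nz: "L z j - m j \<noteq> 0" if "z \<in> \<Omega>" for z j using less[OF that, of j] by auto
  have "cmod (\<phi> z $ j) < 1" if "z \<in> \<Omega>" for z j
    using less[OF that, of j] by (simp add: \<phi> norm_divide divide_less_eq_1)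
  then show sub: "\<phi> ` \<Omega> \<subseteq> polydisc 1" by blast
  have "bounded (polydisc 1 :: (complex ^ 'n) set)"
  proof (rule boundedI)
    fix w :: "complex ^ 'n" assume w: "w \<in> polydisc 1"
    have "norm w \<le> (\<Sum>i\<in>UNIV. cmod (w $ i))" unfolding norm_vec_def by (intro L2_set_le_sum) auto
    also have "\<dots> \<le> (\<Sum>i\<in>(UNIV::'n set). 1)" using w by (intro sum_mono) (auto intro: less_imp_le)
    finally show "norm w \<le> CARD('n)" by simp
  qed
  then have bdd: "bounded (\<phi> ` \<Omega>)" using sub by (rule bounded_subset)
  have inj: "inj_on \<phi> \<Omega>"
  proof (rule inj_onI)
    fix z w assume zw: "z \<in> \<Omega>" "w \<in> \<Omega>" "\<phi> z = \<phi> w"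
    have "L z j = L w j" for j
    proof -
      have "L z j / (L z j - m j) = L w j / (L w j - m j)" using zw(3) by (metis \<phi>)
      then have "L z j * (L w j - m j) = L w j * (L z j - m j)"
        using nz[OF zw(1), of j] nz[OF zw(2), of j] by (simp add: frac_eq_eq)
      then have "m j * (L z j - L w j) = 0" by (auto simp: algebra_simps)
      then show ?thesis using m0 by auto
    qed
    then have "A *v (z - x) = A *v (w - x)" by (simp add: vec_eq_iff L_def)
    then have "B *v (A *v (z - x)) = B *v (A *v (w - x))" by simp
    then show "z = w" by (simp add: matrix_vector_mul_assoc BA)
  qed
  have hol: "holomorphic_map_on \<phi> \<Omega>"
    unfolding holomorphic_map_on_def
  proof
    fix z assume z: "z \<in> \<Omega>"
    define D where "D = (\<chi> j k. - m j / (L z j - m j)\<^sup>2 * A $ j $ k)"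
    have "(\<phi> has_derivative (\<lambda>h. D *v h)) (at z within \<Omega>)"
    proof (rule has_derivative_vec)
      fix j
      have "((\<lambda>\<zeta>. \<zeta> / (\<zeta> - m j)) has_field_derivative (- m j / (L z j - m j)\<^sup>2)) (at (L z j))"
        using nz[OF z, of j] by (auto intro!: derivative_eq_intros simp: power2_eq_square)
      moreover have "bounded_linear (\<lambda>h. (A *v h) $ j)"
        by (rule bounded_linear_compose[OF bounded_linear_vec_nth]) simp
      then have "((\<lambda>z. L z j) has_derivative (\<lambda>h. (A *v h) $ j)) (at z within \<Omega>)"
        unfolding L_def by (rule bounded_linear.has_derivative) (auto intro!: derivative_eq_intros)
      ultimately have "((\<lambda>z. L z j / (L z j - m j)) has_derivative
          (\<lambda>h. - m j / (L z j - m j)\<^sup>2 * (A *v h) $ j)) (at z within \<Omega>)"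
        unfolding has_field_derivative_def by (rule has_derivative_compose[rotated])
      moreover have "(D *v h) $ j = - m j / (L z j - m j)\<^sup>2 * (A *v h) $ j" for h
        by (simp add: D_def matrix_vector_mult_def sum_distrib_left mult.assoc)
      ultimately show "((\<lambda>z. \<phi> z $ j) has_derivative (\<lambda>h. (D *v h) $ j)) (at z within \<Omega>)"
        by (simp add: \<phi>)
    qed
    then show "\<exists>D. (\<phi> has_derivative (\<lambda>h. D *v h)) (at z within \<Omega>)" by blast
  qed
  have "\<phi> x = 0" by (simp add: vec_eq_iff \<phi> L_def)
  with hol inj bdd show "\<phi> \<in> bounded_embeddings \<Omega> x" by (simp add: bounded_embeddings_def)
qed

section \<open>Exit points and supporting half planes\<close>

lemma exit_point:
  fixes \<Omega> :: "'a::real_normed_vector set"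
  assumes "open \<Omega>" and "x \<in> \<Omega>" and "x + v \<notin> \<Omega>"
  obtains s where "0 < s" and "s \<le> 1" and "x + s *\<^sub>R v \<in> frontier \<Omega>"
proof -
  have "closed_segment x (x + v) \<inter> frontier \<Omega> \<noteq> {}"
    using assms(2,3) by (intro connected_Int_frontier) (auto simp: connected_segment)
  then obtain p where "p \<in> closed_segment x (x + v)" and p: "p \<in> frontier \<Omega>" by blast
  then obtain s where s: "0 \<le> s" "s \<le> 1" "p = x + s *\<^sub>R v"
    by (auto simp: in_segment algebra_simps)
  have "p \<notin> \<Omega>" using p assms(1) by (simp add: frontier_def interior_open)
  then have "s \<noteq> 0" using assms(2) s(3) by auto
  then show thesis using that[of s] s p by simp
qed

text \<open>\<open>B *v axis j 1\<close> moves only the \<open>j\<close>-th coordinate of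
  \<open>A\<close>, so the exit point agrees with \<open>x\<close> in all others. A supporting half
  plane at the exit point in another coordinate would have \<open>x\<close> on its boundary, which
  the strict inequality forbids.\<close>

lemma exit_normals:
  fixes A B :: "complex ^ 'n::finite ^ 'n"
  assumes AB: "A ** B = mat 1" and "open \<Omega>" and x: "x \<in> \<Omega>"
    and bound: "\<And>z. z \<in> \<Omega> \<Longrightarrow> Re ((A *v (z - q)) $ j) < 0"
    and normals: "\<And>p. p \<in> frontier \<Omega> \<Longrightarrow> dist p q < \<eta> \<Longrightarrow>
      \<exists>k c. cmod c = 1 \<and> cmod (c - 1) < \<epsilon> \<and> (\<forall>z\<in>\<Omega>. Re (cnj c * (A *v (z - p)) $ k) < 0)"
    and small: "dist x q + norm (A *v (x - q)) * norm (B *v axis j 1) < \<eta>"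
  obtains t c where "0 < t" and "t \<le> norm (A *v (x - q))" and "cmod c = 1" and "cmod (c - 1) < \<epsilon>"
    and "x + t *\<^sub>R (B *v axis j 1) \<in> frontier \<Omega>"
    and "\<And>z. z \<in> \<Omega> \<Longrightarrow> Re (cnj c * ((A *v (z - x)) $ j - of_real t)) < 0"
proof -
  define v where "v = B *v axis j 1"
  have Av: "A *v v = axis j 1" by (simp add: v_def matrix_vector_mul_assoc AB)
  have As: "A *v (s *\<^sub>R v) = s *\<^sub>R axis j 1" for s
    by (simp add: linear_scale[OF matrix_vector_mul_linear] Av)
  \<comment> \<open>At time \<open>T\<close> the line reaches real part 0 in coordinate
    \<open>j\<close>, a value that no point of \<open>\<Omega>\<close> attains, so it has left
    \<open>\<Omega>\<close> by then.\<close>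
  define T where "T = - Re ((A *v (x - q)) $ j)"
  have "T > 0" using bound[OF x] by (simp add: T_def)
  have "T \<le> cmod ((A *v (x - q)) $ j)" unfolding T_def using abs_Re_le_cmod[of "(A *v (x - q)) $ j"] by linarith
  also have "\<dots> \<le> norm (A *v (x - q))" by (rule Finite_Cartesian_Product.norm_nth_le)
  finally have T_le: "T \<le> norm (A *v (x - q))" .
  have "x + T *\<^sub>R v - q = (x - q) + T *\<^sub>R v" by simp
  then have "A *v (x + T *\<^sub>R v - q) = A *v (x - q) + T *\<^sub>R axis j 1"
    by (simp only: matrix_vector_right_distrib As)
  then have "Re ((A *v (x + T *\<^sub>R v - q)) $ j) = 0" by (simp add: T_def axis_def)
  then have "x + T *\<^sub>R v \<notin> \<Omega>" using bound by force
  then obtain s where s: "0 < s" "s \<le> 1" "x + s *\<^sub>R (T *\<^sub>R v) \<in> frontier \<Omega>"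
    using exit_point assms(2) x by blast
  define t where "t = s * T"
  have "t \<le> T" unfolding t_def using s \<open>T > 0\<close> by (intro mult_left_le_one_le) auto
  then have t: "0 < t" "t \<le> norm (A *v (x - q))"
    using T_le s(1) \<open>T > 0\<close> by (simp add: t_def, linarith)
  have p: "x + t *\<^sub>R v \<in> frontier \<Omega>" using s(3) by (simp add: t_def)
  have "dist (x + t *\<^sub>R v) q \<le> dist x q + norm (t *\<^sub>R v)"
    unfolding dist_norm by (metis add_diff_eq add.commute norm_triangle_ineq)
  also have "norm (t *\<^sub>R v) \<le> norm (A *v (x - q)) * norm v"
    using t by (simp add: mult_right_mono)
  finally have "dist (x + t *\<^sub>R v) q < \<eta>" using small by (simp add: v_def)
  from normals[OF p this] obtain k c where c: "cmod c = 1" "cmod (c - 1) < \<epsilon>"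
    and half: "\<And>z. z \<in> \<Omega> \<Longrightarrow> Re (cnj c * (A *v (z - (x + t *\<^sub>R v))) $ k) < 0" by blast
  have split: "A *v (z - (x + t *\<^sub>R v)) = A *v (z - x) - t *\<^sub>R axis j 1" for z
    by (simp only: diff_diff_eq[symmetric] matrix_vector_mult_diff_distrib As)
  have "k = j"
  proof (rule ccontr)
    assume "k \<noteq> j"
    then show False using half[OF x] unfolding split by (simp add: axis_def)
  qed
  have "Re (cnj c * ((A *v (z - x)) $ j - of_real t)) < 0" if "z \<in> \<Omega>" for z
    using half[OF that] unfolding split \<open>k = j\<close> by (simp add: axis_def)
  then show thesis using that[of t c] t c p by (simp add: v_def)
qed

text \<open>The preimage \<open>z\<close> of a point of the small polydisc is written down
  explicitly. Were it outside \<open>\<Omega>\<close>, the segment from \<open>x\<close> to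
  \<open>z\<close> would meet the frontier at some \<open>p'\<close>, and the half space at
  \<open>p'\<close>, in some coordinate \<open>k\<close>, would exclude the exit point in direction
  \<open>k\<close> from the closure of \<open>\<Omega>\<close>.\<close>

lemma corner_embedding:
  fixes A B :: "complex ^ 'n::finite ^ 'n"
  assumes BA: "B ** A = mat 1" and AB: "A ** B = mat 1" and "open \<Omega>" and x: "x \<in> \<Omega>"
    and bound: "\<And>z j. z \<in> \<Omega> \<Longrightarrow> Re ((A *v (z - q)) $ j) < 0"
    and r: "0 < r" "r < 1" and \<epsilon>: "\<epsilon> = (1 - r)\<^sup>2 / 64"
    and normals: "\<And>p. p \<in> frontier \<Omega> \<Longrightarrow> dist p q < \<eta> \<Longrightarrow>
      \<exists>k c. cmod c = 1 \<and> cmod (c - 1) < \<epsilon> \<and> (\<forall>z\<in>\<Omega>. Re (cnj c * (A *v (z - p)) $ k) < 0)"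
    and K: "\<And>y. norm (A *v y) \<le> K * norm y" "\<And>y. norm (B *v y) \<le> K * norm y" "K \<ge> 0"
    and small: "dist x q * (1 + K * K * (1 + CARD('n) * (2 / (1 - r)))) < \<eta>"
  obtains \<phi> where "\<phi> \<in> bounded_embeddings \<Omega> x" and "polydisc r \<subseteq> \<phi> ` \<Omega>" and "\<phi> ` \<Omega> \<subseteq> polydisc 1"
proof -
  have "\<epsilon> \<le> 1 / 64" using r by (simp add: \<epsilon> power_le_one)
  let ?C = "2 / (1 - r)"
  have Kd: "norm (A *v (x - q)) \<le> K * dist x q" using K(1)[of "x - q"] by (simp add: dist_norm)
  \<comment> \<open>Added to \<open>dist x q\<close>, the second summand controls the distance to
    \<open>q\<close> of the exit points along the axes, the third that of the point
    \<open>p'\<close>; these are the points to which \<open>normals\<close> is applied.\<close>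
  have expand: "dist x q * (1 + K * K * (1 + CARD('n) * ?C)) =
    dist x q + K * dist x q * K + K * (CARD('n) * (K * dist x q * ?C))" by (simp add: algebra_simps)
  have nonneg: "0 \<le> K * dist x q * K" "0 \<le> K * (CARD('n) * (K * dist x q * ?C))"
    using K(3) r by (auto intro!: mult_nonneg_nonneg)
  have small1: "dist x q + norm (A *v (x - q)) * norm (B *v axis j 1) < \<eta>" for j
  proof -
    have "norm (B *v axis j 1) \<le> K" using K(2)[of "axis j 1"] by simp
    then have "norm (A *v (x - q)) * norm (B *v axis j 1) \<le> K * dist x q * K"
      using Kd K(3) by (intro mult_mono) auto
    then show ?thesis using small nonneg unfolding expand by linarith
  qed
  have "\<exists>t c. 0 < t \<and> t \<le> norm (A *v (x - q)) \<and> cmod c = 1 \<and> cmod (c - 1) < \<epsilon> \<and>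
      x + t *\<^sub>R (B *v axis j 1) \<in> frontier \<Omega> \<and>
      (\<forall>z\<in>\<Omega>. Re (cnj c * ((A *v (z - x)) $ j - of_real t)) < 0)" for j
    using exit_normals[OF AB \<open>open \<Omega>\<close> x bound normals small1] by metis
  then obtain t c where t: "\<And>j. 0 < t j" "\<And>j. t j \<le> norm (A *v (x - q))"
    and c: "\<And>j. cmod (c j) = 1" "\<And>j. cmod (c j - 1) < \<epsilon>"
    and p: "\<And>j. x + t j *\<^sub>R (B *v axis j 1) \<in> frontier \<Omega>"
    and half: "\<And>j z. z \<in> \<Omega> \<Longrightarrow> Re (cnj (c j) * ((A *v (z - x)) $ j - of_real (t j))) < 0"
    by metis
  have Rec: "Re (c j) > 0" for j
    using abs_Re_le_cmod[of "c j - 1"] c(2)[of j] \<open>\<epsilon> \<le> 1 / 64\<close> by simp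
  have Rec_le: "Re (c j) \<le> 1" for j using complex_Re_le_cmod[of "c j"] c(1) by simp
  define \<phi> where "\<phi> = (\<lambda>z. \<chi> j. (A *v (z - x)) $ j / ((A *v (z - x)) $ j - 2 * of_real (t j * Re (c j)) * c j))"
  have emb: "\<phi> \<in> bounded_embeddings \<Omega> x" "\<phi> ` \<Omega> \<subseteq> polydisc 1"
    unfolding \<phi>_def using Cayley_embedding[OF BA c(1) t(1) Rec half] by auto
  have "w \<in> \<phi> ` \<Omega>" if w: "w \<in> polydisc r" for w
  proof -
    define u where "u = (\<lambda>j. 2 * w $ j / (1 - w $ j))"
    \<comment> \<open>Inverts the Cayley transform in each coordinate:
      \<open>\<zeta> / (\<zeta> - 2 * m) = w\<close> has the solution
      \<open>\<zeta> = - m * u\<close> with \<open>m = t * Re c * c\<close>.\<close>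
    define \<zeta> where "\<zeta> = (\<chi> j. - (of_real (t j * Re (c j)) * c j * u j))"
    define z where "z = x + B *v \<zeta>"
    have u: "cmod (u j) \<le> ?C" "(1 - r\<^sup>2) / 4 \<le> Re (1 + u j)" for j
      using Re_Cayley_bound[of "w $ j" r] w r by (auto simp: u_def)
    have Az: "A *v (z - x) = \<zeta>" by (simp add: z_def matrix_vector_mul_assoc AB)
    have "\<phi> z $ j = w $ j" for j
    proof -
      define m where "m = of_real (t j * Re (c j)) * c j"
      have "m \<noteq> 0" using t(1)[of j] Rec[of j] c(1)[of j] by (auto simp: m_def)
      have "w $ j \<noteq> 1" using w r by (auto dest!: spec[of _ j])
      have "\<zeta> $ j = - (m * u j)" by (simp add: \<zeta>_def m_def)
      moreover have "\<zeta> $ j - 2 * m = - (2 * m / (1 - w $ j))"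
        using \<open>w $ j \<noteq> 1\<close> unfolding \<open>\<zeta> $ j = - (m * u j)\<close> by (simp add: u_def field_simps)
      ultimately have "\<zeta> $ j / (\<zeta> $ j - 2 * m) = w $ j"
        using \<open>w $ j \<noteq> 1\<close> \<open>m \<noteq> 0\<close> by (simp add: u_def)
      then show ?thesis by (simp add: \<phi>_def Az m_def mult.assoc)
    qed
    then have \<phi>z: "\<phi> z = w" by (simp add: vec_eq_iff)
    have "z \<in> \<Omega>"
    proof (rule ccontr)
      assume "z \<notin> \<Omega>"
      then obtain s where s: "0 < s" "s \<le> 1" and p': "x + s *\<^sub>R (z - x) \<in> frontier \<Omega>"
        using exit_point[OF \<open>open \<Omega>\<close> x, of "z - x"] by auto
      define p' where "p' = x + s *\<^sub>R (z - x)"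
      have "cmod (\<zeta> $ j) \<le> K * dist x q * ?C" for j
      proof -
        have "cmod (\<zeta> $ j) = t j * Re (c j) * cmod (u j)"
          using t(1)[of j] Rec[of j] c(1)[of j] by (simp add: \<zeta>_def norm_mult)
        also have "\<dots> \<le> t j * 1 * ?C"
          using t(1)[of j] Rec[of j] Rec_le[of j] u(1)[of j] by (intro mult_mono) (auto intro: less_imp_le)
        also have "\<dots> \<le> K * dist x q * ?C"
          using order_trans[OF t(2)[of j] Kd] r by (intro mult_right_mono) auto
        finally show ?thesis .
      qed
      then have "(\<Sum>j\<in>UNIV. cmod (\<zeta> $ j)) \<le> (\<Sum>j\<in>(UNIV :: 'n set). K * dist x q * ?C)"
        by (intro sum_mono) auto
      moreover have "norm \<zeta> \<le> (\<Sum>j\<in>UNIV. cmod (\<zeta> $ j))"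
        unfolding norm_vec_def by (intro L2_set_le_sum) auto
      ultimately have "norm \<zeta> \<le> CARD('n) * (K * dist x q * ?C)" by simp
      then have "K * norm \<zeta> \<le> K * (CARD('n) * (K * dist x q * ?C))"
        using K(3) by (rule mult_left_mono)
      moreover have "norm (z - x) \<le> K * norm \<zeta>" using K(2)[of \<zeta>] by (simp add: z_def)
      moreover have "norm (s *\<^sub>R (z - x)) \<le> norm (z - x)" using s by (simp add: mult_left_le_one_le)
      moreover have "dist p' q \<le> dist x q + norm (s *\<^sub>R (z - x))"
        using norm_triangle_ineq[of "x - q" "s *\<^sub>R (z - x)"] by (simp add: p'_def dist_norm algebra_simps)
      ultimately have "dist p' q < \<eta>" using small nonneg unfolding expand by linarith
      then obtain k f where f: "cmod f = 1" "cmod (f - 1) < \<epsilon>"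
        and sep: "\<And>y. y \<in> \<Omega> \<Longrightarrow> Re (cnj f * (A *v (y - p')) $ k) < 0"
        using normals[of p'] p' unfolding p'_def by blast
      have As: "A *v (a *\<^sub>R y) = a *\<^sub>R (A *v y)" for a y
        by (rule linear_scale[OF matrix_vector_mul_linear])
      have Ap': "A *v (y - p') = A *v (y - x) - s *\<^sub>R \<zeta>" for y
        by (simp only: p'_def diff_diff_eq[symmetric] matrix_vector_mult_diff_distrib As Az[symmetric])
      \<comment> \<open>Evaluating the half space of \<open>p'\<close> at \<open>x\<close> shows
        that \<open>\<zeta>\<close> points outwards in coordinate \<open>k\<close>.\<close>
      have "Re (cnj f * (A *v (x - x) - s *\<^sub>R \<zeta>) $ k) = - (s * Re (cnj f * \<zeta> $ k))"
        by (simp add: algebra_simps)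
      then have "s * Re (cnj f * \<zeta> $ k) > 0" using sep[OF x] unfolding Ap' by linarith
      then have f\<zeta>: "Re (cnj f * \<zeta> $ k) > 0" using s(1) by (rule zero_less_mult_pos)
      \<comment> \<open>The exit point in direction \<open>k\<close> lies in the closure of
        \<open>\<Omega>\<close>, so it satisfies the inequality of the half space at
        \<open>p'\<close> in non-strict form.\<close>
      define pk where "pk = x + t k *\<^sub>R (B *v axis k 1)"
      have "bounded_linear (\<lambda>h. (A *v h) $ k)"
        by (rule bounded_linear_compose[OF bounded_linear_vec_nth]) simp
      then have cont: "continuous_on UNIV (\<lambda>y. (A *v (y - x)) $ k)"
        by (rule bounded_linear.continuous_on) (intro continuous_intros)
      have "closed {y. Re (cnj f * ((A *v (y - x) - s *\<^sub>R \<zeta>) $ k)) \<le> 0}"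
        unfolding vector_minus_component
        by (rule closed_Collect_le) (rule continuous_intros cont)+
      then have "closure \<Omega> \<subseteq> {y. Re (cnj f * ((A *v (y - x) - s *\<^sub>R \<zeta>) $ k)) \<le> 0}"
        by (rule closure_minimal[rotated]) (use sep in \<open>auto simp: Ap' intro: less_imp_le\<close>)
      moreover have "pk \<in> closure \<Omega>" using p[of k] by (simp add: pk_def frontier_def)
      ultimately have "Re (cnj f * ((A *v (pk - x) - s *\<^sub>R \<zeta>) $ k)) \<le> 0" by blast
      moreover have "A *v (pk - x) = t k *\<^sub>R axis k 1"
        by (simp add: pk_def As matrix_vector_mul_assoc AB)
      ultimately have "Re (cnj f * (of_real (t k) - of_real s * \<zeta> $ k)) \<le> 0"
        by (simp add: axis_def)
      \<comment> \<open>Since \<open>\<zeta>\<close> points outwards and \<open>s \<le> 1\<close>,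
        the inequality survives when \<open>s\<close> is replaced by 1, that is, when
        \<open>p'\<close> is moved to \<open>z\<close>.\<close>
      moreover have "(1 - s) * Re (cnj f * \<zeta> $ k) \<ge> 0"
        using f\<zeta> s by simp
      ultimately have le: "Re (cnj f * (of_real (t k) - \<zeta> $ k)) \<le> 0"
        by (simp add: algebra_simps)
      \<comment> \<open>Factoring out the positive number \<open>t k * Re (c k)\<close> leaves the
        expression of \<open>Re_near_normals_pos\<close>, whose real part is positive.\<close>
      have "of_real (t k) - \<zeta> $ k = of_real (t k * Re (c k)) * (of_real (1 / Re (c k)) + c k * u k)"
        using Rec[of k] by (simp add: \<zeta>_def algebra_simps)
      then have "cnj f * (of_real (t k) - \<zeta> $ k) =
          of_real (t k * Re (c k)) * (cnj f * (of_real (1 / Re (c k)) + c k * u k))" by simp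
      then have "Re (cnj f * (of_real (t k) - \<zeta> $ k)) =
          t k * Re (c k) * Re (cnj f * (of_real (1 / Re (c k)) + c k * u k))"
        by (metis Re_complex_of_real Im_complex_of_real times_complex.sel(1) mult_zero_left diff_0_right)
      moreover have "Re (cnj f * (of_real (1 / Re (c k)) + c k * u k)) > 0"
        by (rule Re_near_normals_pos[OF r \<epsilon> c f u])
      ultimately show False using le t(1)[of k] Rec[of k] by (simp add: mult_le_0_iff)
    qed
    then show ?thesis using \<phi>z by blast
  qed
  then have "polydisc r \<subseteq> \<phi> ` \<Omega>" by blast
  with emb show thesis using that by blast
qed

section \<open>Passage to the limit at the corner\<close>

lemma maximal_circularity_tendsto_1:
  fixes A B :: "complex ^ 'n::finite ^ 'n"
  assumes BA: "B ** A = mat 1" and AB: "A ** B = mat 1" and "open \<Omega>"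
    and bound: "\<And>z j. z \<in> \<Omega> \<Longrightarrow> Re ((A *v (z - q)) $ j) < 0"
    and normals: "\<And>\<epsilon>. \<epsilon> > 0 \<Longrightarrow> \<exists>\<eta>>0. \<forall>p\<in>frontier \<Omega>. dist p q < \<eta> \<longrightarrow>
      (\<exists>k c. cmod c = 1 \<and> cmod (c - 1) < \<epsilon> \<and> (\<forall>z\<in>\<Omega>. Re (cnj c * (A *v (z - p)) $ k) < 0))"
  shows "(maximal_circularity \<Omega> \<longlongrightarrow> 1) (at q within \<Omega>)"
proof -
  obtain K1 where K1: "\<And>y. norm (A *v y) \<le> norm y * K1"
    using bounded_linear.bounded[OF matrix_vector_mul_bounded_linear] by blast
  obtain K2 where K2: "\<And>y. norm (B *v y) \<le> norm y * K2"
    using bounded_linear.bounded[OF matrix_vector_mul_bounded_linear] by blast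
  define K where "K = max 0 (max K1 K2)"
  have K: "norm (A *v y) \<le> K * norm y" "norm (B *v y) \<le> K * norm y" for y
  proof -
    have "norm y * K1 \<le> norm y * K" "norm y * K2 \<le> norm y * K"
      by (intro mult_left_mono; simp add: K_def)+
    then show "norm (A *v y) \<le> K * norm y" "norm (B *v y) \<le> K * norm y"
      using K1[of y] K2[of y] by (simp_all add: mult.commute)
  qed
  have "K \<ge> 0" by (simp add: K_def)
  have near: "\<forall>\<^sub>F x in at q within \<Omega>. r\<^sup>2 \<le> maximal_circularity \<Omega> x \<and> maximal_circularity \<Omega> x \<le> 1"
    if r: "0 < r" "r < 1" for r
  proof -
    define \<epsilon> where "\<epsilon> = (1 - r)\<^sup>2 / 64"
    have "\<epsilon> > 0" using r by (simp add: \<epsilon>_def)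
    then obtain \<eta> where "\<eta> > 0" and \<eta>: "\<And>p. p \<in> frontier \<Omega> \<Longrightarrow> dist p q < \<eta> \<Longrightarrow>
      \<exists>k c. cmod c = 1 \<and> cmod (c - 1) < \<epsilon> \<and> (\<forall>z\<in>\<Omega>. Re (cnj c * (A *v (z - p)) $ k) < 0)"
      using normals by meson
    \<comment> \<open>The factor of \<open>dist x q\<close> in the smallness condition of
      \<open>corner_embedding\<close>, so that \<open>\<eta> / M\<close> is a sufficient
      radius.\<close>
    define M where "M = 1 + K * K * (1 + CARD('n) * (2 / (1 - r)))"
    have "M > 0" using r \<open>K \<ge> 0\<close> unfolding M_def by (intro add_pos_nonneg) auto
    have "r\<^sup>2 \<le> maximal_circularity \<Omega> x \<and> maximal_circularity \<Omega> x \<le> 1"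
      if x: "x \<in> \<Omega>" "dist x q < \<eta> / M" for x
    proof -
      have small: "dist x q * (1 + K * K * (1 + CARD('n) * (2 / (1 - r)))) < \<eta>"
        using x(2) \<open>M > 0\<close> by (simp only: pos_less_divide_eq M_def)
      obtain \<phi> where "\<phi> \<in> bounded_embeddings \<Omega> x" "polydisc r \<subseteq> \<phi> ` \<Omega>" "\<phi> ` \<Omega> \<subseteq> polydisc 1"
        by (rule corner_embedding[OF BA AB \<open>open \<Omega>\<close> x(1) bound r \<epsilon>_def \<eta> K \<open>K \<ge> 0\<close> small])
      then show ?thesis using maximal_circularity_bounds[OF \<open>open \<Omega>\<close> x(1) r(1)] by blast
    qed
    moreover have "\<eta> / M > 0" using \<open>\<eta> > 0\<close> \<open>M > 0\<close> by simp
    ultimately show ?thesis unfolding eventually_at by blast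
  qed
  have one_half: "1 / 2 < (1 :: real)" by simp
  show ?thesis
  proof (rule order_tendstoI)
    fix a :: real assume "a < 1"
    \<comment> \<open>The square of \<open>r\<close> is the midpoint of 1 and the positive part of
      \<open>a\<close>, hence above \<open>a\<close>; the maximum with 0 keeps it positive for
      negative \<open>a\<close>.\<close>
    define r where "r = sqrt ((1 + max a 0) / 2)"
    have r: "0 < r" "r < 1" "a < r\<^sup>2" using \<open>a < 1\<close> by (auto simp: r_def)
    show "\<forall>\<^sub>F x in at q within \<Omega>. a < maximal_circularity \<Omega> x"
      using near[OF r(1,2)] by eventually_elim (use r(3) in auto)
  next
    \<comment> \<open>The upper bound 1 comes with every \<open>r\<close>; the value 1/2 is an
      arbitrary choice.\<close>
    fix a :: real assume "1 < a"
    show "\<forall>\<^sub>F x in at q within \<Omega>. maximal_circularity \<Omega> x < a"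
      using near[OF half_gt_zero[OF zero_less_one] one_half]
      by eventually_elim (use \<open>1 < a\<close> in auto)
  qed
qed

section \<open>Gradients and Hessians\<close>

text \<open>\<open>gradient\<close> is a definite description, so existence and uniqueness of the
  representing vector are both proved; existence is the Riesz representation in the orthonormal
  \<open>Basis\<close>.\<close>

lemma gradient_has_derivative:
  fixes f :: "'a::euclidean_space \<Rightarrow> real"
  assumes "f differentiable at z"
  shows "(f has_derivative (\<lambda>h. h \<bullet> gradient f z)) (at z)"
proof -
  obtain f' where f': "(f has_derivative f') (at z)" using assms by (auto simp: differentiable_def)
  define D where "D = (\<Sum>b\<in>Basis. f' b *\<^sub>R b)"
  have "f' h = h \<bullet> D" for h
  proof -
    interpret bounded_linear f' using f' by (rule has_derivative_bounded_linear)
    have "f' h = f' (\<Sum>b\<in>Basis. (h \<bullet> b) *\<^sub>R b)" by (simp add: euclidean_representation)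
    also have "\<dots> = h \<bullet> D" by (simp add: sum scaleR D_def inner_sum_right mult.commute)
    finally show ?thesis .
  qed
  then have D: "GDERIV f z :> D" using f' unfolding gderiv_def by (metis (no_types, lifting) ext)
  have "D' = D" if "GDERIV f z :> D'" for D'
    using has_derivative_unique[OF that[unfolded gderiv_def] D[unfolded gderiv_def]]
    by (metis vector_eq_ldot)
  then have "gradient f z = D" unfolding gradient_def using D by (intro the_equality)
  then show ?thesis using D by (simp add: gderiv_def)
qed

lemma frechet_derivative_gradient:
  fixes f :: "'a::euclidean_space \<Rightarrow> real"
  assumes "f differentiable at z"
  shows "frechet_derivative f (at z) h = h \<bullet> gradient f z"
  using frechet_derivative_at[OF gradient_has_derivative[OF assms]] by metis

text \<open>\<open>smooth_on\<close> speaks of directional derivatives, one vector at a time.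
  Expanding the gradient in \<open>Basis\<close> turns them into differentiability of the gradient
  map and continuity of the Hessian.\<close>

lemma smooth_on_gradient:
  fixes f :: "'a::euclidean_space \<Rightarrow> real"
  assumes smooth: "smooth_on f U" and "open U"
  shows smooth_on_has_derivative: "z \<in> U \<Longrightarrow> (f has_derivative (\<lambda>h. h \<bullet> gradient f z)) (at z)"
    and smooth_on_gradient_has_derivative:
      "z \<in> U \<Longrightarrow> (gradient f has_derivative frechet_derivative (gradient f) (at z)) (at z)"
    and smooth_on_continuous_hessian: "continuous_on U (\<lambda>z. frechet_derivative (gradient f) (at z) u)"
proof -
  have diff: "f differentiable at z" if "z \<in> U" for z
    using smooth[unfolded smooth_on_def, rule_format, of 1] that by simp
  then show "z \<in> U \<Longrightarrow> (f has_derivative (\<lambda>h. h \<bullet> gradient f z)) (at z)"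
    by (rule gradient_has_derivative)
  define P where "P = (\<lambda>v z. frechet_derivative f (at z) v)"
  define Q where "Q = (\<lambda>v z u. frechet_derivative (P v) (at z) u)"
  have "k_times_differentiable_on (Suc (Suc 0)) f U" using smooth by (simp add: smooth_on_def)
  then have PQ: "(\<forall>v. \<forall>z\<in>U. P v differentiable at z) \<and> (\<forall>v u. continuous_on U (\<lambda>z. Q v z u))"
    by (simp add: P_def Q_def)
  then have P_diff: "P v differentiable at z" if "z \<in> U" for v z using that by blast
  have Q_cont: "continuous_on U (\<lambda>z. Q v z u)" for v u using PQ by blast
  have grad: "gradient f z = (\<Sum>b\<in>Basis. P b z *\<^sub>R b)" if "z \<in> U" for z
    using frechet_derivative_gradient[OF diff[OF that]]
    by (simp add: P_def euclidean_representation inner_commute[of _ "gradient f z"])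
  have der: "(gradient f has_derivative (\<lambda>u. \<Sum>b\<in>Basis. Q b z u *\<^sub>R b)) (at z)" if "z \<in> U" for z
  proof -
    have "(P b has_derivative Q b z) (at z)" for b
      unfolding Q_def using P_diff[OF that] frechet_derivative_works by blast
    then have "((\<lambda>z. \<Sum>b\<in>Basis. P b z *\<^sub>R b) has_derivative (\<lambda>u. \<Sum>b\<in>Basis. Q b z u *\<^sub>R b)) (at z)"
      by (intro has_derivative_sum has_derivative_scaleR_left)
    then show ?thesis
      by (rule has_derivative_transform_within_open[OF _ \<open>open U\<close> that]) (simp add: grad)
  qed
  then show "z \<in> U \<Longrightarrow> (gradient f has_derivative frechet_derivative (gradient f) (at z)) (at z)"
    unfolding frechet_derivative_works[symmetric] by (blast intro: differentiableI)
  have "frechet_derivative (gradient f) (at z) u = (\<Sum>b\<in>Basis. Q b z u *\<^sub>R b)" if "z \<in> U" for z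
    by (simp flip: frechet_derivative_at[OF der[OF that]])
  moreover have "continuous_on U (\<lambda>z. \<Sum>b\<in>Basis. Q b z u *\<^sub>R b)"
    by (intro continuous_intros Q_cont)
  ultimately show "continuous_on U (\<lambda>z. frechet_derivative (gradient f) (at z) u)"
    by (simp cong: continuous_on_cong)
qed

section \<open>Symmetry of the Hessian\<close>

lemma mixed_difference:
  fixes f :: "'a::euclidean_space \<Rightarrow> real" and G' :: "'a \<Rightarrow> 'a \<Rightarrow> 'a"
  assumes f: "\<And>z. z \<in> U \<Longrightarrow> (f has_derivative (\<lambda>h. h \<bullet> G z)) (at z)"
    and G: "\<And>z. z \<in> U \<Longrightarrow> (G has_derivative G' z) (at z)"
    and "s > 0" and U: "\<And>a b. 0 \<le> a \<Longrightarrow> a \<le> s \<Longrightarrow> 0 \<le> b \<Longrightarrow> b \<le> s \<Longrightarrow> z + a *\<^sub>R u + b *\<^sub>R v \<in> U"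
  shows "\<exists>a b. 0 \<le> a \<and> a \<le> s \<and> 0 \<le> b \<and> b \<le> s \<and>
    f (z + s *\<^sub>R u + s *\<^sub>R v) - f (z + s *\<^sub>R u) - f (z + s *\<^sub>R v) + f z =
      s * s * (G' (z + a *\<^sub>R u + b *\<^sub>R v) v \<bullet> u)"
proof -
  \<comment> \<open>The mean value theorem is used twice: for \<open>\<phi>\<close> in direction
    \<open>u\<close>, then for the resulting difference of \<open>u \<bullet> G\<close> in direction
    \<open>v\<close>.\<close>
  define \<phi> where "\<phi> = (\<lambda>a. f (z + a *\<^sub>R u + s *\<^sub>R v) - f (z + a *\<^sub>R u + 0 *\<^sub>R v))"
  have f_line: "((\<lambda>a. f (z + a *\<^sub>R u + b *\<^sub>R v)) has_field_derivative u \<bullet> G (z + a *\<^sub>R u + b *\<^sub>R v)) (at a)"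
    if "0 \<le> a" "a \<le> s" "0 \<le> b" "b \<le> s" for a b
  proof -
    have "((\<lambda>a. z + a *\<^sub>R u + b *\<^sub>R v) has_derivative (\<lambda>t. t *\<^sub>R u)) (at a)"
      by (auto intro!: derivative_eq_intros)
    from has_derivative_compose[OF this f[OF U[OF that]]] show ?thesis
      by (simp add: has_field_derivative_def mult_commute_abs)
  qed
  have "(\<phi> has_field_derivative u \<bullet> (G (z + a *\<^sub>R u + s *\<^sub>R v) - G (z + a *\<^sub>R u + 0 *\<^sub>R v))) (at a)"
    if "0 \<le> a" "a \<le> s" for a
    unfolding \<phi>_def inner_diff_right using that \<open>s > 0\<close> by (intro DERIV_diff f_line) auto
  from MVT2[OF \<open>s > 0\<close> this] obtain a where a: "0 < a" "a < s"
    "\<phi> s - \<phi> 0 = (s - 0) * (u \<bullet> (G (z + a *\<^sub>R u + s *\<^sub>R v) - G (z + a *\<^sub>R u + 0 *\<^sub>R v)))"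
    by blast
  have "((\<lambda>b. u \<bullet> G (z + a *\<^sub>R u + b *\<^sub>R v)) has_field_derivative u \<bullet> G' (z + a *\<^sub>R u + b *\<^sub>R v) v) (at b)"
    if "0 \<le> b" "b \<le> s" for b
  proof -
    let ?w = "z + a *\<^sub>R u + b *\<^sub>R v"
    have "?w \<in> U" using U a that by simp
    have "((\<lambda>b. z + a *\<^sub>R u + b *\<^sub>R v) has_derivative (\<lambda>t. t *\<^sub>R v)) (at b)"
      by (auto intro!: derivative_eq_intros)
    from has_derivative_inner_right[OF has_derivative_compose[OF this G[OF \<open>?w \<in> U\<close>]], of u]
    have "((\<lambda>b. u \<bullet> G (z + a *\<^sub>R u + b *\<^sub>R v)) has_derivative (\<lambda>t. u \<bullet> G' ?w (t *\<^sub>R v))) (at b)" .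
    moreover have "G' ?w (t *\<^sub>R v) = t *\<^sub>R G' ?w v" for t
      using has_derivative_bounded_linear[OF G[OF \<open>?w \<in> U\<close>]] by (simp add: linear_simps)
    ultimately show ?thesis by (simp add: has_field_derivative_def mult_commute_abs)
  qed
  from MVT2[OF \<open>s > 0\<close> this] obtain b where b: "0 < b" "b < s"
    "u \<bullet> G (z + a *\<^sub>R u + s *\<^sub>R v) - u \<bullet> G (z + a *\<^sub>R u + 0 *\<^sub>R v) =
      (s - 0) * (u \<bullet> G' (z + a *\<^sub>R u + b *\<^sub>R v) v)" by blast
  have "\<phi> s - \<phi> 0 = s * s * (G' (z + a *\<^sub>R u + b *\<^sub>R v) v \<bullet> u)"
    using a(3) b(3) by (simp add: inner_diff_right inner_commute)
  moreover have "\<phi> s - \<phi> 0 = f (z + s *\<^sub>R u + s *\<^sub>R v) - f (z + s *\<^sub>R u) - f (z + s *\<^sub>R v) + f z"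
    by (simp add: \<phi>_def)
  ultimately show ?thesis using a b by (metis less_imp_le)
qed

text \<open>The mixed difference is symmetric in \<open>u\<close> and \<open>v\<close>, so the mean
  value theorem in the two orders gives equal Hessian values at two points near \<open>z\<close>;
  continuity carries the equality to \<open>z\<close>.\<close>

lemma hessian_symmetric:
  fixes f :: "'a::euclidean_space \<Rightarrow> real" and G' :: "'a \<Rightarrow> 'a \<Rightarrow> 'a"
  assumes "open U" and "z \<in> U" and f: "\<And>z. z \<in> U \<Longrightarrow> (f has_derivative (\<lambda>h. h \<bullet> G z)) (at z)"
    and G: "\<And>z. z \<in> U \<Longrightarrow> (G has_derivative G' z) (at z)"
    and cont: "\<And>u. continuous_on U (\<lambda>z. G' z u)"
  shows "G' z u \<bullet> v = G' z v \<bullet> u"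
proof (rule ccontr)
  assume neq: "G' z u \<bullet> v \<noteq> G' z v \<bullet> u"
  \<comment> \<open>Half the gap: two errors below \<open>\<epsilon>\<close> cannot bridge
    it.\<close>
  define \<epsilon> where "\<epsilon> = \<bar>G' z u \<bullet> v - G' z v \<bullet> u\<bar> / 2"
  have "\<epsilon> > 0" using neq by (simp add: \<epsilon>_def)
  have near: "\<forall>\<^sub>F w in nhds z. \<bar>G' w u \<bullet> v - G' z u \<bullet> v\<bar> < \<epsilon>" for u v
  proof -
    have "isCont (\<lambda>z. G' z u \<bullet> v) z"
      using continuous_on_inner[OF cont continuous_on_const] assms(1,2)
      by (simp add: continuous_on_eq_continuous_at)
    then have "((\<lambda>z. G' z u \<bullet> v) \<longlongrightarrow> G' z u \<bullet> v) (nhds z)"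
      unfolding isCont_def by (rule iffD1[OF tendsto_at_iff_tendsto_nhds])
    then show ?thesis using \<open>\<epsilon> > 0\<close> by (auto simp: tendsto_iff dist_real_def)
  qed
  have "\<forall>\<^sub>F w in nhds z. w \<in> U \<and> \<bar>G' w u \<bullet> v - G' z u \<bullet> v\<bar> < \<epsilon> \<and> \<bar>G' w v \<bullet> u - G' z v \<bullet> u\<bar> < \<epsilon>"
    by (intro eventually_conj near eventually_nhds_in_open assms(1,2))
  then obtain d where "d > 0" and d: "\<And>w. dist w z < d \<Longrightarrow>
      w \<in> U \<and> \<bar>G' w u \<bullet> v - G' z u \<bullet> v\<bar> < \<epsilon> \<and> \<bar>G' w v \<bullet> u - G' z v \<bullet> u\<bar> < \<epsilon>"
    unfolding eventually_nhds_metric by blast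
  \<comment> \<open>Chosen so that the whole parallelogram spanned at \<open>z\<close> by
    \<open>s *\<^sub>R u\<close> and \<open>s *\<^sub>R v\<close> stays within distance
    \<open>d\<close>.\<close>
  define s where "s = d / (2 * (norm u + norm v + 1))"
  have pos: "norm u + norm v + 1 > 0" by (smt (verit) norm_ge_zero)
  have "s > 0" using \<open>d > 0\<close> pos by (simp add: s_def)
  have "d / (2 * T) * T = d / 2" if "T > 0" for T using that by simp
  from this[OF pos] have "s * (norm u + norm v + 1) = d / 2" by (simp only: s_def)
  then have sd: "s * norm u + s * norm v < d" using \<open>s > 0\<close> \<open>d > 0\<close> by (simp add: algebra_simps)
  have close: "dist (z + a *\<^sub>R u + b *\<^sub>R v) z < d" if "0 \<le> a" "a \<le> s" "0 \<le> b" "b \<le> s" for a b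
  proof -
    have "dist (z + a *\<^sub>R u + b *\<^sub>R v) z = norm (a *\<^sub>R u + b *\<^sub>R v)" by (simp add: dist_norm)
    also have "\<dots> \<le> norm (a *\<^sub>R u) + norm (b *\<^sub>R v)" by (rule norm_triangle_ineq)
    also have "\<dots> \<le> s * norm u + s * norm v" using that by (auto intro!: add_mono mult_right_mono)
    finally show ?thesis using sd by simp
  qed
  have U1: "z + a *\<^sub>R u + b *\<^sub>R v \<in> U" if "0 \<le> a" "a \<le> s" "0 \<le> b" "b \<le> s" for a b
    using d close[OF that] by blast
  then have U2: "z + a *\<^sub>R v + b *\<^sub>R u \<in> U" if "0 \<le> a" "a \<le> s" "0 \<le> b" "b \<le> s" for a b
    using that by (metis add.assoc add.commute)
  obtain a b where ab: "0 \<le> a" "a \<le> s" "0 \<le> b" "b \<le> s"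
    "f (z + s *\<^sub>R u + s *\<^sub>R v) - f (z + s *\<^sub>R u) - f (z + s *\<^sub>R v) + f z =
      s * s * (G' (z + a *\<^sub>R u + b *\<^sub>R v) v \<bullet> u)"
    using mixed_difference[OF f G \<open>s > 0\<close> U1] by blast
  obtain a' b' where ab': "0 \<le> a'" "a' \<le> s" "0 \<le> b'" "b' \<le> s"
    "f (z + s *\<^sub>R v + s *\<^sub>R u) - f (z + s *\<^sub>R v) - f (z + s *\<^sub>R u) + f z =
      s * s * (G' (z + a' *\<^sub>R v + b' *\<^sub>R u) u \<bullet> v)"
    using mixed_difference[OF f G \<open>s > 0\<close> U2] by blast
  define w where "w = z + a *\<^sub>R u + b *\<^sub>R v"
  define w' where "w' = z + a' *\<^sub>R v + b' *\<^sub>R u"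
  have w'_eq: "w' = z + b' *\<^sub>R u + a' *\<^sub>R v" by (simp add: w'_def)
  have swap: "z + s *\<^sub>R v + s *\<^sub>R u = z + s *\<^sub>R u + s *\<^sub>R v" by simp
  have "s * s * (G' w v \<bullet> u) = s * s * (G' w' u \<bullet> v)"
    using ab(5) ab'(5) unfolding swap w_def[symmetric] w'_def[symmetric] by linarith
  then have "G' w v \<bullet> u = G' w' u \<bullet> v" using \<open>s > 0\<close> by simp
  moreover have "\<bar>G' w v \<bullet> u - G' z v \<bullet> u\<bar> < \<epsilon>" using d close[OF ab(1-4)] by (simp add: w_def)
  moreover have "\<bar>G' w' u \<bullet> v - G' z u \<bullet> v\<bar> < \<epsilon>"
    using d close[OF ab'(3,4,1,2)] unfolding w'_eq by blast
  ultimately have "\<bar>G' z u \<bullet> v - G' z v \<bullet> u\<bar> < \<epsilon> + \<epsilon>" by linarith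
  then show False by (simp add: \<epsilon>_def)
qed

section \<open>Wirtinger derivatives and the Levi form\<close>

lemma inner_complex_vec:
  fixes x y :: "complex ^ 'n::finite"
  shows "x \<bullet> y = Re (\<Sum>i\<in>UNIV. x $ i * cnj (y $ i))"
  by (simp add: inner_vec_def inner_complex_def)

lemma real_linear_complex_vec:
  fixes T :: "complex ^ 'n::finite \<Rightarrow> 'b::real_vector"
  assumes "linear T"
  shows "T v = (\<Sum>j\<in>UNIV. Re (v $ j) *\<^sub>R T (axis j 1) + Im (v $ j) *\<^sub>R T (axis j \<i>))"
proof -
  have "v = (\<Sum>j\<in>UNIV. Re (v $ j) *\<^sub>R axis j 1 + Im (v $ j) *\<^sub>R axis j \<i>)"
    by (simp add: vec_eq_iff axis_def complex_eq_iff if_distrib sum.distrib cong: if_cong)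
  also have "T \<dots> = (\<Sum>j\<in>UNIV. Re (v $ j) *\<^sub>R T (axis j 1) + Im (v $ j) *\<^sub>R T (axis j \<i>))"
    by (simp add: linear_sum[OF assms] linear_add[OF assms] linear_scale[OF assms])
  finally show ?thesis .
qed

text \<open>Translates the data of Levi flatness into the gradient: complex tangency becomes
  Hermitian orthogonality to \<open>gradient f z\<close>.\<close>

lemma wirtinger_real:
  fixes f :: "complex ^ 'n::finite \<Rightarrow> real"
  assumes "f differentiable at z"
  shows "wirtinger j (\<lambda>w. complex_of_real (f w)) z = cnj (gradient f z $ j) / 2"
    and "wirtinger_bar j (\<lambda>w. complex_of_real (f w)) z = gradient f z $ j / 2"
proof -
  have "((\<lambda>w. complex_of_real (f w)) has_derivative (\<lambda>h. of_real (h \<bullet> gradient f z))) (at z)"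
    using gradient_has_derivative[OF assms] by (rule has_derivative_of_real)
  then have "frechet_derivative (\<lambda>w. complex_of_real (f w)) (at z) h = of_real (h \<bullet> gradient f z)" for h
    by (metis frechet_derivative_at)
  then show "wirtinger j (\<lambda>w. complex_of_real (f w)) z = cnj (gradient f z $ j) / 2"
    and "wirtinger_bar j (\<lambda>w. complex_of_real (f w)) z = gradient f z $ j / 2"
    by (simp_all add: wirtinger_def wirtinger_bar_def inner_axis' complex_eq_iff)
qed

text \<open>Since \<open>wirtinger_bar k\<close> of \<open>f\<close> is half the \<open>k\<close>-th
  gradient component, its Wirtinger derivatives assemble to the complex linear part of
  \<open>G'\<close>, that is, to a multiple of \<open>G' v - \<i> * G' (\<i> *s v)\<close>. In the
  pairing with \<open>v\<close> the factor \<open>- \<i>\<close> moves to the conjugated side and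
  becomes the second \<open>\<i> *s v\<close>.\<close>

lemma levi_form_hessian:
  fixes f :: "complex ^ 'n::finite \<Rightarrow> real"
  assumes "smooth_on f U" and "open U" and z: "z \<in> U"
  defines "G' \<equiv> frechet_derivative (gradient f) (at z)"
  shows "4 * Re (levi_form f z v) = G' v \<bullet> v + G' (\<i> *s v) \<bullet> (\<i> *s v)"
proof -
  have G': "(gradient f has_derivative G') (at z)"
    unfolding G'_def using smooth_on_gradient_has_derivative assms(1-3) by blast
  then have "linear G'" by (metis has_derivative_linear)
  have wb: "frechet_derivative (wirtinger_bar k (\<lambda>w. complex_of_real (f w))) (at z) h = G' h $ k / 2" for k h
  proof -
    have "((\<lambda>w. gradient f w $ k / 2) has_derivative (\<lambda>h. G' h $ k / 2)) (at z)"
      by (intro bounded_linear.has_derivative[OF bounded_linear_divide]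
        bounded_linear.has_derivative[OF bounded_linear_vec_nth] G')
    then have "(wirtinger_bar k (\<lambda>w. complex_of_real (f w)) has_derivative (\<lambda>h. G' h $ k / 2)) (at z)"
    proof (rule has_derivative_transform_within_open[OF _ \<open>open U\<close> z])
      fix w assume "w \<in> U"
      then have "f differentiable at w" using smooth_on_has_derivative assms(1,2) by (metis differentiable_def)
      then show "gradient f w $ k / 2 = wirtinger_bar k (\<lambda>w. complex_of_real (f w)) w"
        by (simp add: wirtinger_real)
    qed
    then show ?thesis by (metis frechet_derivative_at)
  qed
  have "(\<Sum>j\<in>UNIV. (G' (axis j 1) $ k - \<i> * G' (axis j \<i>) $ k) * v $ j) = (G' v $ k - \<i> * G' (\<i> *s v) $ k)" for k
    unfolding real_linear_complex_vec[OF \<open>linear G'\<close>, of v]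
      real_linear_complex_vec[OF \<open>linear G'\<close>, of "\<i> *s v"]
    by (simp add: sum_distrib_left flip: sum_subtractf)
      (rule sum.cong[OF refl], simp add: complex_eq_iff algebra_simps)
  moreover have "4 * levi_form f z v = (\<Sum>k\<in>UNIV. (\<Sum>j\<in>UNIV. (G' (axis j 1) $ k - \<i> * G' (axis j \<i>) $ k) * v $ j) * cnj (v $ k))"
    unfolding levi_form_def wirtinger_def[of _ "wirtinger_bar _ _"] wb
    by (subst sum.swap, unfold sum_distrib_left sum_distrib_right, intro sum.cong refl)
      (simp add: field_simps)
  ultimately have "4 * levi_form f z v = (\<Sum>k\<in>UNIV. (G' v $ k - \<i> * G' (\<i> *s v) $ k) * cnj (v $ k))"
    by simp
  then have "Re (4 * levi_form f z v) = Re (\<Sum>k\<in>UNIV. (G' v $ k - \<i> * G' (\<i> *s v) $ k) * cnj (v $ k))"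
    by simp
  then show ?thesis
    unfolding inner_complex_vec by (simp add: algebra_simps sum.distrib sum_subtractf sum_negf)
qed

section \<open>Levi flat corners of convex domains\<close>

text \<open>If the derivative at \<open>p\<close> towards a point \<open>y\<close> of
  \<open>\<Omega>\<close> were positive, \<open>f\<close> would be positive just after
  \<open>p\<close> on the segment to \<open>y\<close>; but by convexity and openness that open
  segment lies in \<open>\<Omega>\<close>.\<close>

lemma convex_gradient_supports:
  fixes f :: "'a::euclidean_space \<Rightarrow> real"
  assumes "convex \<Omega>" and "open \<Omega>" and neg: "\<And>z. z \<in> \<Omega> \<Longrightarrow> f z < 0" and p: "p \<in> closure \<Omega>" "f p = 0"
    and f: "(f has_derivative (\<lambda>h. h \<bullet> G)) (at p)" and "G \<noteq> 0" and z: "z \<in> \<Omega>"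
  shows "(z - p) \<bullet> G < 0"
proof -
  have le: "(y - p) \<bullet> G \<le> 0" if y: "y \<in> \<Omega>" for y
  proof (rule ccontr)
    assume pos: "\<not> (y - p) \<bullet> G \<le> 0"
    have "((\<lambda>t. p + t *\<^sub>R (y - p)) has_derivative (\<lambda>t. t *\<^sub>R (y - p))) (at 0)"
      by (auto intro!: derivative_eq_intros)
    from has_derivative_compose[OF this, of f "\<lambda>h. h \<bullet> G"] f
    have "((\<lambda>t. f (p + t *\<^sub>R (y - p))) has_field_derivative (y - p) \<bullet> G) (at 0)"
      by (simp add: has_field_derivative_def mult_commute_abs)
    from DERIV_pos_inc_right[OF this] pos obtain d where "d > 0"
      and d: "\<And>t. 0 < t \<Longrightarrow> t < d \<Longrightarrow> f p < f (p + t *\<^sub>R (y - p))" by auto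
    define t where "t = min (d / 2) (1 / 2)"
    have t: "0 < t" "t < d" "t < 1" using \<open>d > 0\<close> by (auto simp: t_def)
    have "y \<noteq> p" using neg y p(2) by force
    then have "p + t *\<^sub>R (y - p) \<in> open_segment y p"
      using t by (auto simp: in_segment algebra_simps intro!: exI[of _ "1 - t"])
    then have "p + t *\<^sub>R (y - p) \<in> \<Omega>"
      using in_interior_closure_convex_segment[OF \<open>convex \<Omega>\<close> _ p(1), of y] y \<open>open \<Omega>\<close>
      by (auto simp: interior_open)
    then show False using neg d[OF t(1,2)] p(2) by force
  qed
  \<comment> \<open>Strictness: a small step from \<open>z\<close> along \<open>G\<close> stays in
    \<open>\<Omega>\<close> and raises the inner product by the positive amount
    \<open>s * (G \<bullet> G)\<close>.\<close>
  obtain r where r: "r > 0" "cball z r \<subseteq> \<Omega>" using \<open>open \<Omega>\<close> z open_contains_cball by blast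
  define s where "s = r / norm G"
  have "s > 0" using r \<open>G \<noteq> 0\<close> by (simp add: s_def)
  have "z + s *\<^sub>R G \<in> cball z r" using r \<open>G \<noteq> 0\<close> by (simp add: s_def dist_norm)
  then have "(z + s *\<^sub>R G - p) \<bullet> G \<le> 0" using le r(2) by blast
  then have "(z - p) \<bullet> G + s * (G \<bullet> G) \<le> 0" by (simp add: algebra_simps)
  moreover have "s * (G \<bullet> G) > 0" using \<open>s > 0\<close> \<open>G \<noteq> 0\<close> by simp
  ultimately show ?thesis by linarith
qed

text \<open>The derivative along the line vanishes at 0 and decreases there, so it is negative just
  after 0; the mean value theorem passes the sign on to \<open>f\<close>.\<close>

lemma second_derivative_neg_imp_neg:
  fixes f :: "'a::euclidean_space \<Rightarrow> real"
  assumes "open U" and "p \<in> U" and f: "\<And>z. z \<in> U \<Longrightarrow> (f has_derivative (\<lambda>h. h \<bullet> G z)) (at z)"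
    and G: "(G has_derivative G') (at p)" and "f p = 0" and "u \<bullet> G p = 0" and neg: "G' u \<bullet> u < 0"
  shows "\<forall>\<^sub>F s in at_right 0. f (p + s *\<^sub>R u) < 0"
proof -
  have line: "((\<lambda>t. p + t *\<^sub>R u) has_derivative (\<lambda>t. t *\<^sub>R u)) (at s)" for s
    by (auto intro!: derivative_eq_intros)
  have "((\<lambda>t. u \<bullet> G (p + t *\<^sub>R u)) has_derivative (\<lambda>t. u \<bullet> G' (t *\<^sub>R u))) (at 0)"
    by (intro has_derivative_inner_right has_derivative_compose[OF line]) (simp add: G)
  moreover have "G' (t *\<^sub>R u) = t *\<^sub>R G' u" for t
    using has_derivative_bounded_linear[OF G] by (simp add: linear_simps)
  ultimately have "((\<lambda>t. u \<bullet> G (p + t *\<^sub>R u)) has_field_derivative G' u \<bullet> u) (at 0)"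
    by (simp add: has_field_derivative_def mult_commute_abs inner_commute)
  from DERIV_neg_dec_right[OF this neg] assms(6) obtain d where "d > 0"
    and d: "\<And>t. 0 < t \<Longrightarrow> t < d \<Longrightarrow> u \<bullet> G (p + t *\<^sub>R u) < 0" by auto
  have "((\<lambda>t. p + t *\<^sub>R u) \<longlongrightarrow> p + 0 *\<^sub>R u) (at_right 0)" by (intro tendsto_intros)
  then have "\<forall>\<^sub>F t in at_right 0. p + t *\<^sub>R u \<in> U"
    using topological_tendstoD[OF _ \<open>open U\<close>] \<open>p \<in> U\<close> by fastforce
  then obtain b where "b > 0" and b: "\<And>t. 0 < t \<Longrightarrow> t < b \<Longrightarrow> p + t *\<^sub>R u \<in> U"
    unfolding eventually_at_right_field by blast
  have "f (p + s *\<^sub>R u) < 0" if s: "0 < s" "s < min b d" for s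
  proof -
    have "((\<lambda>t. f (p + t *\<^sub>R u)) has_field_derivative u \<bullet> G (p + t *\<^sub>R u)) (at t)" if "0 \<le> t" "t \<le> s" for t
    proof -
      have "p + t *\<^sub>R u \<in> U" using b[of t] that s \<open>p \<in> U\<close> by (cases "t = 0") auto
      from has_derivative_compose[OF line f[OF this]] show ?thesis
        by (simp add: has_field_derivative_def mult_commute_abs)
    qed
    from MVT2[OF s(1) this] obtain t where "0 < t" "t < s"
      "f (p + s *\<^sub>R u) - f (p + 0 *\<^sub>R u) = (s - 0) * (u \<bullet> G (p + t *\<^sub>R u))" by blast
    moreover have "u \<bullet> G (p + t *\<^sub>R u) < 0" using d calculation(1,2) s by simp
    ultimately show ?thesis using s(1) assms(5) by (simp add: mult_pos_neg)
  qed
  then show ?thesis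
    unfolding eventually_at_right_field using \<open>b > 0\<close> \<open>d > 0\<close> by (intro exI[of _ "min b d"]) auto
qed

text \<open>Because \<open>T v \<bullet> v = 0\<close>, the form is affine in \<open>s\<close>, and
  an affine function bounded below is constant.\<close>

lemma psd_form_kernel:
  fixes T :: "'a::real_inner \<Rightarrow> 'a"
  assumes "linear T" and sym: "T u \<bullet> v = T v \<bullet> u" and "T v \<bullet> v = 0"
    and psd: "\<And>s. T (u + s *\<^sub>R v) \<bullet> (u + s *\<^sub>R v) \<ge> 0"
  shows "T u \<bullet> v = 0"
proof (rule ccontr)
  assume c: "T u \<bullet> v \<noteq> 0"
  \<comment> \<open>At this \<open>s\<close> the form takes the value -1.\<close>
  define s where "s = - ((T u \<bullet> u + 1) / 2) / (T u \<bullet> v)"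
  have "s * (T u \<bullet> v) = - ((T u \<bullet> u + 1) / 2)" using c by (simp add: s_def)
  moreover have "T (u + s *\<^sub>R v) \<bullet> (u + s *\<^sub>R v) = T u \<bullet> u + 2 * (s * (T u \<bullet> v))"
    using assms(2,3) by (simp add: linear_add[OF assms(1)] linear_scale[OF assms(1)] algebra_simps)
  ultimately show False using psd[of s] by simp
qed

text \<open>Indexing the functions active at \<open>q\<close> by the coordinate type makes their
  conjugated gradients a square matrix; with the conjugation, the real part of its
  \<open>k\<close>-th row functional is the differential of \<open>f k\<close> at \<open>q\<close>.
  By \<open>local\<close> these functions alone describe \<open>\<Omega>\<close> near
  \<open>q\<close>.\<close>

locale levi_flat_corner =
  fixes \<Omega> U :: "(complex ^ 'n::finite) set" and f :: "'n \<Rightarrow> complex ^ 'n \<Rightarrow> real"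
    and q :: "complex ^ 'n" and e :: real and B :: "complex ^ 'n ^ 'n"
  assumes open_\<Omega>: "open \<Omega>" and convex_\<Omega>: "convex \<Omega>" and open_U: "open U" and cl_U: "closure \<Omega> \<subseteq> U"
    and smooth: "smooth_on (f k) U" and e_pos: "e > 0" and ball_U: "ball q e \<subseteq> U"
    and q_frontier: "q \<in> frontier \<Omega>" and f_q: "f k q = 0" and neg: "z \<in> \<Omega> \<Longrightarrow> f k z < 0"
    and local: "z \<in> ball q e \<Longrightarrow> (\<And>k. f k z < 0) \<Longrightarrow> z \<in> \<Omega>"
    and flat: "levi_flat (f k) {z \<in> frontier \<Omega>. f k z = 0}"
    and inverse: "B ** (\<chi> k i. cnj (gradient (f k) q $ i)) = mat 1"
begin

abbreviation "G k \<equiv> gradient (f k)"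
abbreviation "A \<equiv> (\<chi> k i. cnj (G k q $ i))"
abbreviation "G' k z \<equiv> frechet_derivative (G k) (at z)"

lemma A_nth: "(A *v h) $ k = (\<Sum>i\<in>UNIV. h $ i * cnj (G k q $ i))"
  by (simp add: matrix_vector_mult_def mult.commute)

lemma f_der: "z \<in> U \<Longrightarrow> (f k has_derivative (\<lambda>h. h \<bullet> G k z)) (at z)"
  using smooth_on_has_derivative[OF smooth open_U] .

lemma G_der: "z \<in> U \<Longrightarrow> (G k has_derivative G' k z) (at z)"
  using smooth_on_gradient_has_derivative[OF smooth open_U] .

lemma q_U: "q \<in> U"
  using ball_U e_pos by auto

lemma f_cont: "continuous_on U (f k)"
  by (rule has_derivative_continuous_on) (use f_der has_derivative_at_withinI in blast)

lemma G_cont: "continuous_on U (G k)"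
  by (rule has_derivative_continuous_on) (use G_der has_derivative_at_withinI in blast)

lemma f_closure: "p \<in> closure \<Omega> \<Longrightarrow> f k p \<le> 0"
  using continuous_le_on_closure[of \<Omega> "f k" p 0] continuous_on_subset[OF f_cont cl_U] neg
  by (metis less_imp_le)

lemma G_q_nonzero: "G k q \<noteq> 0"
proof
  assume "G k q = 0"
  have "A ** B = mat 1" using inverse matrix_left_right_inverse by blast
  then have "(A *v (B *v axis k 1)) $ k = 1" by (simp add: matrix_vector_mul_assoc axis_def)
  then show False using \<open>G k q = 0\<close> unfolding A_nth by simp
qed

text \<open>Stepping from \<open>p\<close> against the gradient of \<open>f j\<close> makes
  \<open>f j\<close> negative to first order, while the other functions stay negative by continuity.
  The result gives access to Levi flatness, which is assumed only on the frontier.\<close>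

lemma face_interior_frontier:
  assumes p: "p \<in> ball q e" and "f j p = 0" and others: "\<And>k. k \<noteq> j \<Longrightarrow> f k p < 0" and "G j p \<noteq> 0"
  shows "p \<in> frontier \<Omega>"
proof -
  have "p \<notin> \<Omega>" using neg[of p j] assms(2) by auto
  have "p \<in> U" using p ball_U by blast
  let ?z = "\<lambda>s. p - s *\<^sub>R G j p"
  have tends: "(?z \<longlongrightarrow> p) (at_right 0)" by (auto intro!: tendsto_eq_intros)
  have "(f j has_derivative (\<lambda>h. h \<bullet> G j p)) (at (?z 0))" using f_der[OF \<open>p \<in> U\<close>] by simp
  moreover have "(?z has_derivative (\<lambda>s. - (s *\<^sub>R G j p))) (at 0)"
    by (auto intro!: derivative_eq_intros)
  ultimately have "((\<lambda>s. f j (?z s)) has_derivative (\<lambda>s. - (s *\<^sub>R G j p) \<bullet> G j p)) (at 0)"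
    by (rule has_derivative_compose[rotated])
  moreover have "(\<lambda>s. - (s *\<^sub>R G j p) \<bullet> G j p) = (*) (- (G j p \<bullet> G j p))" by (simp add: fun_eq_iff)
  ultimately have "((\<lambda>s. f j (?z s)) has_field_derivative - (G j p \<bullet> G j p)) (at 0)"
    by (simp only: has_field_derivative_def)
  from DERIV_neg_dec_right[OF this] assms(2,4) have j: "\<forall>\<^sub>F s in at_right 0. f j (?z s) < 0"
    unfolding eventually_at_right_field by auto
  have ball: "\<forall>\<^sub>F s in at_right 0. ?z s \<in> ball q e"
    using topological_tendstoD[OF tends] p by blast
  have "\<forall>\<^sub>F s in at_right 0. f k (?z s) < 0" for k
  proof (cases "k = j")
    case False
    have "isCont (f k) p" using f_cont open_U \<open>p \<in> U\<close> by (simp add: continuous_on_eq_continuous_at)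
    then have "((\<lambda>s. f k (?z s)) \<longlongrightarrow> f k p) (at_right 0)" by (rule isCont_tendsto_compose[OF _ tends])
    then show ?thesis using others[OF False] by (rule order_tendstoD)
  qed (simp add: j)
  then have "\<forall>\<^sub>F s in at_right 0. \<forall>k. f k (?z s) < 0" by (simp add: eventually_all_finite)
  with ball have \<Omega>: "\<forall>\<^sub>F s in at_right 0. ?z s \<in> \<Omega>" by eventually_elim (use local in blast)
  then have "\<forall>\<^sub>F s in at_right 0. ?z s \<in> closure \<Omega>"
    by eventually_elim (use closure_subset in blast)
  then have "p \<in> closure \<Omega>"
    by (rule Lim_in_closed_set[OF closed_closure _ _ tends]) simp
  then show ?thesis using \<open>p \<notin> \<Omega>\<close> open_\<Omega> by (simp add: frontier_def interior_open)
qed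

text \<open>If the second derivative along \<open>u\<close> were negative, both \<open>p + s u\<close> and \<open>p - s u\<close> would lie in
  \<open>\<Omega>\<close> for small \<open>s\<close>, and hence so would their midpoint \<open>p\<close>.\<close>
lemma hessian_psd:
  assumes p: "p \<in> ball q e" and "f j p = 0" and others: "\<And>k. k \<noteq> j \<Longrightarrow> f k p < 0" and u: "u \<bullet> G j p = 0"
  shows "G' j p u \<bullet> u \<ge> 0"
proof (rule ccontr)
  assume "\<not> G' j p u \<bullet> u \<ge> 0"
  then have n: "G' j p u \<bullet> u < 0" by simp
  have "p \<in> U" using p ball_U by blast
  have lin: "linear (G' j p)" using G_der[OF \<open>p \<in> U\<close>] has_derivative_linear by blast
  have \<Omega>: "\<forall>\<^sub>F s in at_right 0. p + s *\<^sub>R w \<in> \<Omega>" if w: "w \<bullet> G j p = 0" "G' j p w \<bullet> w < 0" for w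
  proof -
    have tends: "((\<lambda>s. p + s *\<^sub>R w) \<longlongrightarrow> p) (at_right 0)" by (auto intro!: tendsto_eq_intros)
    have ball: "\<forall>\<^sub>F s in at_right 0. p + s *\<^sub>R w \<in> ball q e"
      using topological_tendstoD[OF tends] p by blast
    have "\<forall>\<^sub>F s in at_right 0. f k (p + s *\<^sub>R w) < 0" for k
    proof (cases "k = j")
      case True
      show ?thesis unfolding True
        by (rule second_derivative_neg_imp_neg[OF open_U \<open>p \<in> U\<close> f_der G_der[OF \<open>p \<in> U\<close>] \<open>f j p = 0\<close> w])
    next
      case False
      have "isCont (f k) p" using f_cont open_U \<open>p \<in> U\<close> by (simp add: continuous_on_eq_continuous_at)
      then have "((\<lambda>s. f k (p + s *\<^sub>R w)) \<longlongrightarrow> f k p) (at_right 0)" by (rule isCont_tendsto_compose[OF _ tends])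
      then show ?thesis using others[OF False] by (rule order_tendstoD)
    qed
    then have "\<forall>\<^sub>F s in at_right 0. \<forall>k. f k (p + s *\<^sub>R w) < 0" by (simp add: eventually_all_finite)
    with ball show ?thesis by eventually_elim (use local in blast)
  qed
  have "\<forall>\<^sub>F s in at_right 0. p + s *\<^sub>R u \<in> \<Omega> \<and> p + s *\<^sub>R (- u) \<in> \<Omega>"
    by (intro eventually_conj \<Omega>) (use u n in \<open>simp_all add: linear_neg[OF lin]\<close>)
  then obtain s :: real where s: "p + s *\<^sub>R u \<in> \<Omega>" "p + s *\<^sub>R (- u) \<in> \<Omega>"
    using eventually_happens'[OF trivial_limit_at_right_real] by blast
  have "(1 / 2) *\<^sub>R (p + s *\<^sub>R u) + (1 / 2) *\<^sub>R (p + s *\<^sub>R (- u)) \<in> \<Omega>"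
    by (rule convexD[OF convex_\<Omega> s]) auto
  then have "p \<in> \<Omega>" by (simp add: algebra_simps flip: scaleR_2 scaleR_left_distrib)
  then show False using neg[of p j] \<open>f j p = 0\<close> by simp
qed

text \<open>By Levi flatness the Hessian at \<open>v\<close> and at \<open>\<i> v\<close> adds up to \<open>0\<close> for complex tangent \<open>v\<close>, so by
  semidefiniteness \<open>v\<close> lies in its kernel. Hence the derivative of the gradient along the face is a
  complex multiple of the gradient.\<close>
lemma derivative_gradient_parallel:
  assumes p: "p \<in> ball q e" and "f j p = 0" and others: "\<And>k. k \<noteq> j \<Longrightarrow> f k p < 0" and "G j p \<noteq> 0"
    and u: "u \<bullet> G j p = 0"
  shows "G' j p u $ i * G j p $ m = G' j p u $ m * G j p $ i"
proof -
  have "p \<in> U" using p ball_U by blast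
  have lin: "linear (G' j p)" using G_der[OF \<open>p \<in> U\<close>] has_derivative_linear by blast
  have sym: "G' j p v \<bullet> w = G' j p w \<bullet> v" for v w
    by (rule hessian_symmetric[OF open_U \<open>p \<in> U\<close> f_der G_der smooth_on_continuous_hessian[OF smooth open_U]])
  have psd: "G' j p w \<bullet> w \<ge> 0" if "w \<bullet> G j p = 0" for w
    using hessian_psd[OF p assms(2) _ that] others by blast
  have p_face: "p \<in> {z \<in> frontier \<Omega>. f j z = 0}"
    using face_interior_frontier[OF p assms(2) _ assms(4)] others assms(2) by simp
  have "f j differentiable at p" using f_der[OF \<open>p \<in> U\<close>] differentiableI by blast
  have orth: "G' j p u \<bullet> v = 0" if v: "(\<Sum>k\<in>UNIV. v $ k * cnj (G j p $ k)) = 0" for v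
  proof -
    have v1: "v \<bullet> G j p = 0" unfolding inner_complex_vec v by simp
    have "(\<Sum>k\<in>UNIV. (\<i> *s v) $ k * cnj (G j p $ k)) = \<i> * (\<Sum>k\<in>UNIV. v $ k * cnj (G j p $ k))"
      by (simp add: sum_distrib_left mult.assoc)
    then have v2: "(\<i> *s v) \<bullet> G j p = 0" unfolding inner_complex_vec v by simp
    have "(\<Sum>k\<in>UNIV. wirtinger k (\<lambda>w. complex_of_real (f j w)) p * (v $ k)) = 0"
      using v by (simp add: wirtinger_real[OF \<open>f j differentiable at p\<close>] mult.commute flip: sum_divide_distrib)
    then have "levi_form (f j) p v = 0" using flat[of j] p_face unfolding levi_flat_def by blast
    then have "G' j p v \<bullet> v + G' j p (\<i> *s v) \<bullet> (\<i> *s v) = 0"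
      using levi_form_hessian[OF smooth open_U \<open>p \<in> U\<close>, of j v] by simp
    then have "G' j p v \<bullet> v = 0" using psd[OF v1] psd[OF v2] by linarith
    moreover have "(u + s *\<^sub>R v) \<bullet> G j p = 0" for s using u v1 by (simp add: inner_add_left)
    ultimately show ?thesis using psd_form_kernel[OF lin sym] psd by blast
  qed
  \<comment> \<open>This \<open>v\<close> is complex orthogonal to the gradient, and its Hermitian
    pairing with \<open>G' j p u\<close> is the two by two minor \<open>c\<close>. Real
    orthogonality to \<open>v\<close> and to \<open>\<i> *s v\<close> kills the real and the
    imaginary part of \<open>c\<close>.\<close>
  define v where "v = axis i (cnj (G j p $ m)) - axis m (cnj (G j p $ i))"
  have prod: "(\<Sum>k\<in>UNIV. axis l a $ k * b k) = a * b l" for l :: 'n and a :: complex and b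
    by (simp add: axis_def if_distrib if_distribR cong: if_cong)
  have v: "(\<Sum>k\<in>UNIV. v $ k * cnj (G j p $ k)) = 0"
    by (simp add: v_def left_diff_distrib sum_subtractf prod)
  have "(\<Sum>k\<in>UNIV. (\<i> *s v) $ k * cnj (G j p $ k)) = \<i> * (\<Sum>k\<in>UNIV. v $ k * cnj (G j p $ k))"
    by (simp add: sum_distrib_left mult.assoc)
  then have iv: "(\<Sum>k\<in>UNIV. (\<i> *s v) $ k * cnj (G j p $ k)) = 0" using v by simp
  define c where "c = G' j p u $ i * G j p $ m - G' j p u $ m * G j p $ i"
  have "(\<Sum>k\<in>UNIV. b k * cnj (axis l a $ k)) = b l * cnj a" for l :: 'n and a :: complex and b
    by (simp add: axis_def if_distrib if_distribR cong: if_cong)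
  then have c: "(\<Sum>k\<in>UNIV. G' j p u $ k * cnj (v $ k)) = c"
    by (simp add: v_def right_diff_distrib sum_subtractf c_def)
  have "(\<Sum>k\<in>UNIV. G' j p u $ k * cnj ((\<i> *s v) $ k)) = - \<i> * (\<Sum>k\<in>UNIV. G' j p u $ k * cnj (v $ k))"
    by (simp add: sum_distrib_left mult.left_commute flip: sum_negf)
  then have ic: "(\<Sum>k\<in>UNIV. G' j p u $ k * cnj ((\<i> *s v) $ k)) = - \<i> * c" by (simp only: c)
  have "Re c = 0" using orth[OF v] unfolding inner_complex_vec c .
  moreover have "Im c = 0" using orth[OF iv] unfolding inner_complex_vec ic by simp
  ultimately show ?thesis by (simp add: c_def complex_eq_iff)
qed

text \<open>The functions \<open>f k\<close>, completed by the imaginary parts of the complex linear coordinates, form a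
  chart at \<open>q\<close> in which the open faces are convex.\<close>
lemma gradient_ratio_const:
  assumes "G j q $ m \<noteq> 0"
  shows "\<exists>\<eta>>0. \<forall>p\<in>frontier \<Omega>. dist p q < \<eta> \<longrightarrow> f j p = 0 \<longrightarrow>
    (\<forall>i. G j p $ i * G j q $ m = G j q $ i * G j p $ m)"
proof -
  have "isCont (G j) q" using G_cont open_U q_U by (simp add: continuous_on_eq_continuous_at)
  then have "isCont (\<lambda>z. G j z $ m) q" by (rule isCont_vec_nth)
  from continuous_at_avoid[OF this assms] obtain e' where "e' > 0"
    and e': "\<And>z. dist q z < e' \<Longrightarrow> G j z $ m \<noteq> 0" by blast
  \<comment> \<open>On \<open>W\<close> the component \<open>m\<close> of the gradient does not
    vanish, so the ratios \<open>h\<close> below make sense.\<close>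
  define W where "W = ball q (min e e')"
  have W: "open W" "q \<in> W" "W \<subseteq> ball q e" "W \<subseteq> U" and Wm: "z \<in> W \<Longrightarrow> G j z $ m \<noteq> 0" for z
    using e' e_pos \<open>e' > 0\<close> ball_U by (auto simp: W_def)
  define F where "F = (\<lambda>z. \<chi> k. Complex (f k z) (Im ((A *v (z - q)) $ k)))"
  define F' where "F' = (\<lambda>z h. \<chi> k. Complex (h \<bullet> G k z) (Im ((A *v h) $ k)))"
  have bl: "bounded_linear (\<lambda>h. Im ((A *v h) $ k))" for k
    by (intro bounded_linear_compose[OF bounded_linear_Im] bounded_linear_compose[OF bounded_linear_vec_nth]) simp
  have Complex: "Complex = (\<lambda>a b. of_real a + \<i> * of_real b)" by (auto simp: complex_eq_iff fun_eq_iff)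
  have F_der: "(F has_derivative F' z) (at z)" if "z \<in> U" for z
  proof (rule has_derivative_vec)
    fix k
    have "((\<lambda>z. Im ((A *v (z - q)) $ k)) has_derivative (\<lambda>h. Im ((A *v h) $ k))) (at z)"
      by (rule bounded_linear.has_derivative[OF bl]) (auto intro!: derivative_eq_intros)
    then show "((\<lambda>x. F x $ k) has_derivative (\<lambda>h. F' z h $ k)) (at z)"
      unfolding F_def F'_def Complex using f_der[OF that, of k]
      by (auto intro!: has_derivative_add has_derivative_mult_right has_derivative_of_real)
  qed
  have F'_bl: "bounded_linear (F' z)" if "z \<in> U" for z
    using F_der[OF that] by (rule has_derivative_bounded_linear)
  \<comment> \<open>The differential of \<open>f k\<close> at \<open>q\<close> is the real part of
    the \<open>k\<close>-th coordinate of \<open>A\<close>, so the chart has the invertible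
    derivative \<open>A\<close> at \<open>q\<close>.\<close>
  have F'_q: "F' q = (*v) A"
    by (simp add: F'_def fun_eq_iff vec_eq_iff A_nth complex_eq_iff inner_complex_vec)
  have F_q: "F q = 0" by (simp add: F_def f_q vec_eq_iff complex_eq_iff)
  define BF where "BF = (\<lambda>z. Blinfun (F' z))"
  have BF: "blinfun_apply (BF z) = F' z" if "z \<in> U" for z
    unfolding BF_def using F'_bl[OF that] by (rule bounded_linear_Blinfun_apply)
  have "continuous_on W BF"
  proof (rule continuous_on_blinfun_componentwise)
    fix h :: "complex ^ 'n"
    have "continuous_on W (\<lambda>z. F' z h)"
      unfolding F'_def Complex
      by (intro continuous_intros continuous_on_subset[OF G_cont \<open>W \<subseteq> U\<close>])
    then show "continuous_on W (\<lambda>z. blinfun_apply (BF z) h)"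
      using W(4) BF by (simp add: subset_iff cong: continuous_on_cong)
  qed
  moreover have "Blinfun ((*v) B) o\<^sub>L BF q = id_blinfun"
    by (rule blinfun_eqI) (simp add: BF[OF q_U] F'_q bounded_linear_Blinfun_apply matrix_vector_mul_assoc inverse)
  moreover have "(F has_derivative blinfun_apply (BF z)) (at z)" if "z \<in> W" for z
    using that W(4) F_der BF by (metis subsetD)
  ultimately obtain U' V g g' where U': "open U'" "U' \<subseteq> W" "q \<in> U'" and V: "open V" "F q \<in> V"
    and hom: "homeomorphism U' V F g" and g_der: "\<And>y. y \<in> V \<Longrightarrow> (g has_derivative g' y) (at y)"
    and g'_inv: "\<And>y. y \<in> V \<Longrightarrow> g' y = inv (blinfun_apply (BF (g y)))"
    and bij: "\<And>y. y \<in> V \<Longrightarrow> bij (blinfun_apply (BF (g y)))"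
    using inverse_function_theorem[OF \<open>open W\<close> _ _ \<open>q \<in> W\<close>] by metis
  have g: "g y \<in> U'" "F (g y) = y" if "y \<in> V" for y
    using hom that by (auto simp: homeomorphism_def)
  have gW: "g y \<in> W" "g y \<in> U" if "y \<in> V" for y using g(1)[OF that] U'(2) W(4) by auto
  obtain d where "d > 0" and d: "ball 0 d \<subseteq> V" using V F_q open_contains_ball by metis
  \<comment> \<open>The open face on which \<open>f j\<close> alone vanishes, seen in the chart: a
    ball cut by a real hyperplane and open half spaces, hence convex.\<close>
  define T where "T = {y \<in> ball 0 d. Re (y $ j) = 0 \<and> (\<forall>k. k \<noteq> j \<longrightarrow> Re (y $ k) < 0)}"
  \<comment> \<open>These ratios describe the complex line of the gradient, independently of its
    complex scale.\<close>
  define h where "h = (\<lambda>i y. G j (g y) $ i / G j (g y) $ m)"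
  have f_g: "f k (g y) = Re (y $ k)" if "y \<in> V" for y k
    using arg_cong[OF g(2)[OF that], of "\<lambda>y. Re (y $ k)"] by (simp add: F_def)
  have h_der: "\<exists>D. (h i has_derivative D) (at y) \<and> (\<forall>w. Re (w $ j) = 0 \<longrightarrow> D w = 0)" if y: "y \<in> T" for i y
  proof -
    have yV: "y \<in> V" using y d by (auto simp: T_def)
    let ?p = "g y"
    have face: "?p \<in> ball q e" "f j ?p = 0" "\<And>k. k \<noteq> j \<Longrightarrow> f k ?p < 0"
      using gW(1)[OF yV] W(3) y by (auto simp: f_g[OF yV] T_def)
    have nz: "G j ?p $ m \<noteq> 0" using Wm gW(1)[OF yV] by blast
    then have "G j ?p \<noteq> 0" by auto
    define D where "D = (\<lambda>w. (G' j ?p (g' y w) $ i * G j ?p $ m - G j ?p $ i * G' j ?p (g' y w) $ m)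
      / (G j ?p $ m * G j ?p $ m))"
    have "((\<lambda>y. G j (g y) $ l) has_derivative (\<lambda>w. G' j ?p (g' y w) $ l)) (at y)" for l
      by (intro bounded_linear.has_derivative[OF bounded_linear_vec_nth]
          has_derivative_compose[OF g_der[OF yV] G_der[OF gW(2)[OF yV]]])
    from has_derivative_divide'[OF this[of i] this[of m] nz] have "(h i has_derivative D) (at y)"
      unfolding h_def D_def .
    \<comment> \<open>A direction tangent to the face in the chart is carried by \<open>g' y\<close>
      to a vector orthogonal to the gradient; the numerator of \<open>D w\<close> is then the minor
      that \<open>derivative_gradient_parallel\<close> makes zero.\<close>
    moreover have "D w = 0" if "Re (w $ j) = 0" for w
    proof -
      have "F' ?p (g' y w) = w"
        using bij[OF yV] unfolding g'_inv[OF yV] BF[OF gW(2)[OF yV]] by (simp add: bij_is_surj surj_f_inv_f)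
      from arg_cong[OF this, of "\<lambda>y. Re (y $ j)"] have "g' y w \<bullet> G j ?p = 0"
        using that by (simp add: F'_def)
      from derivative_gradient_parallel[OF face(1,2) _ \<open>G j ?p \<noteq> 0\<close> this, of i m] face(3)
      have "G' j ?p (g' y w) $ i * G j ?p $ m = G' j ?p (g' y w) $ m * G j ?p $ i" by blast
      then show ?thesis by (simp add: D_def mult.commute)
    qed
    ultimately show ?thesis by blast
  qed
  have h_const: "h i y1 = h i y2" if y12: "y1 \<in> T" "y2 \<in> T" for i y1 y2
  proof -
    have seg: "y1 + s *\<^sub>R (y2 - y1) \<in> T" if s: "s \<in> {0..1}" for s
    proof -
      have eq: "y1 + s *\<^sub>R (y2 - y1) = (1 - s) *\<^sub>R y1 + s *\<^sub>R y2" by (simp add: algebra_simps)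
      have "(1 - s) *\<^sub>R y1 + s *\<^sub>R y2 \<in> ball 0 d"
        using y12 s by (intro convexD[OF convex_ball]) (auto simp: T_def)
      moreover have "(1 - s) * Re (y1 $ k) + s * Re (y2 $ k) < 0" if "k \<noteq> j" for k
        using y12 s that by (intro convex_bound_lt) (auto simp: T_def)
      ultimately show ?thesis using y12 unfolding eq by (simp add: T_def)
    qed
    define \<phi> where "\<phi> = (\<lambda>s. h i (y1 + s *\<^sub>R (y2 - y1)))"
    have "(\<phi> has_derivative (\<lambda>t. 0)) (at s within {0..1})" if s: "s \<in> {0..1}" for s
    proof -
      obtain D where D: "(h i has_derivative D) (at (y1 + s *\<^sub>R (y2 - y1)))"
        and D0: "\<And>w. Re (w $ j) = 0 \<Longrightarrow> D w = 0" using h_der[OF seg[OF s]] by blast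
      have "((\<lambda>s. y1 + s *\<^sub>R (y2 - y1)) has_derivative (\<lambda>t. t *\<^sub>R (y2 - y1))) (at s within {0..1})"
        by (auto intro!: derivative_eq_intros)
      from has_derivative_compose[OF this D]
      have "(\<phi> has_derivative (\<lambda>t. D (t *\<^sub>R (y2 - y1)))) (at s within {0..1})" by (simp add: \<phi>_def)
      moreover have "D (t *\<^sub>R (y2 - y1)) = 0" for t using y12 by (intro D0) (simp add: T_def)
      ultimately show ?thesis by simp
    qed
    from has_derivative_zero_unique[OF convex_real_interval(5) this, of 0 1]
    show ?thesis by (simp add: \<phi>_def)
  qed
  have h_cont: "isCont (h i) y" if y: "y \<in> V" for i y
  proof -
    have "isCont g y" using g_der[OF y] by (rule has_derivative_continuous)
    moreover have "isCont (G j) (g y)"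
      using G_cont open_U gW(2)[OF y] by (simp add: continuous_on_eq_continuous_at)
    ultimately have "isCont (\<lambda>y. G j (g y)) y" by (rule isCont_o2)
    then show ?thesis unfolding h_def using Wm[OF gW(1)[OF y]]
      by (intro isCont_divide isCont_vec_nth) auto
  qed
  \<comment> \<open>Moving along \<open>- w\<close> lowers every real part except the
    \<open>j\<close>-th. This pushes points at which further functions vanish, such as the image 0
    of \<open>q\<close>, into \<open>T\<close>, and constancy of \<open>h\<close> extends to them by
    continuity.\<close>
  define w :: "complex ^ 'n" where "w = (\<chi> k. if k = j then 0 else 1)"
  have approach: "\<forall>\<^sub>F s in at_right 0. y - s *\<^sub>R w \<in> T"
    and approach_lim: "((\<lambda>s. h i (y - s *\<^sub>R w)) \<longlongrightarrow> h i y) (at_right 0)"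
    if y: "y \<in> ball 0 d" "Re (y $ j) = 0" "\<And>k. Re (y $ k) \<le> 0" for y i
  proof -
    have tends: "((\<lambda>s. y - s *\<^sub>R w) \<longlongrightarrow> y) (at_right 0)" by (auto intro!: tendsto_eq_intros)
    then have "\<forall>\<^sub>F s in at_right 0. y - s *\<^sub>R w \<in> ball 0 d"
      using y(1) topological_tendstoD by blast
    moreover have "\<forall>\<^sub>F s in at_right (0 :: real). s > 0" by (rule eventually_at_right_less)
    ultimately show "\<forall>\<^sub>F s in at_right 0. y - s *\<^sub>R w \<in> T"
    proof eventually_elim
      case (elim s)
      have "Re (y $ k) - s < 0" for k using y(3)[of k] elim(2) by linarith
      then show ?case using elim(1) y(2) by (auto simp: T_def w_def)
    qed
    show "((\<lambda>s. h i (y - s *\<^sub>R w)) \<longlongrightarrow> h i y) (at_right 0)"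
      by (rule isCont_tendsto_compose[OF h_cont tends]) (use y(1) d in blast)
  qed
  have h_eq: "h i y = h i 0" if y: "y \<in> ball 0 d" "Re (y $ j) = 0" "\<And>k. Re (y $ k) \<le> 0" for y i
  proof -
    have z: "(0 :: complex ^ 'n) \<in> ball 0 d" "Re ((0 :: complex ^ 'n) $ j) = 0" "\<And>k. Re ((0 :: complex ^ 'n) $ k) \<le> 0"
      using \<open>d > 0\<close> by auto
    have "\<forall>\<^sub>F s in at_right 0. h i (y - s *\<^sub>R w) = h i (0 - s *\<^sub>R w)"
      using approach[OF y] approach[OF z] by eventually_elim (rule h_const)
    then have "((\<lambda>s. h i (0 - s *\<^sub>R w)) \<longlongrightarrow> h i y) (at_right 0)"
      using approach_lim[OF y] by (rule Lim_transform_eventually[rotated])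
    then show ?thesis
      using tendsto_unique[OF trivial_limit_at_right_real _ approach_lim[OF z]] by blast
  qed
  have gF: "g (F p) = p" if "p \<in> U'" for p using hom that by (auto simp: homeomorphism_def)
  have "isCont F q" using F_der[OF q_U] by (rule has_derivative_continuous)
  then have "(F \<longlongrightarrow> F q) (nhds q)"
    unfolding isCont_def by (rule iffD1[OF tendsto_at_iff_tendsto_nhds])
  moreover have "F q \<in> ball 0 d" using \<open>d > 0\<close> F_q by simp
  ultimately have "\<forall>\<^sub>F p in nhds q. F p \<in> ball 0 d"
    by (rule topological_tendstoD[OF _ open_ball])
  moreover have "\<forall>\<^sub>F p in nhds q. p \<in> U'" using U' by (intro eventually_nhds_in_open)
  ultimately have "\<forall>\<^sub>F p in nhds q. F p \<in> ball 0 d \<and> p \<in> U'" by (rule eventually_conj)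
  then obtain \<eta> where "\<eta> > 0" and \<eta>: "\<And>p. dist p q < \<eta> \<Longrightarrow> F p \<in> ball 0 d \<and> p \<in> U'"
    unfolding eventually_nhds_metric by blast
  have "G j p $ i * G j q $ m = G j q $ i * G j p $ m"
    if p: "p \<in> frontier \<Omega>" "dist p q < \<eta>" "f j p = 0" for p i
  proof -
    have "f k p \<le> 0" for k using p(1) f_closure by (simp add: frontier_def)
    then have "h i (F p) = h i 0" using \<eta>[OF p(2)] p(3) by (intro h_eq) (auto simp: F_def)
    moreover have "g (F p) = p" "g 0 = q" using gF \<eta>[OF p(2)] U'(3) F_q by metis+
    ultimately have "G j p $ i / G j p $ m = G j q $ i / G j q $ m" by (simp add: h_def)
    moreover have "G j p $ m \<noteq> 0" using Wm \<eta>[OF p(2)] U'(2) by blast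
    ultimately show ?thesis using assms by (simp add: frac_eq_eq)
  qed
  then show ?thesis using \<open>\<eta> > 0\<close> by blast
qed

text \<open>By \<open>local\<close>, at every frontier point \<open>p\<close> near \<open>q\<close>
  some \<open>f k\<close> vanishes, and by \<open>gradient_ratio_const\<close> its gradient there is
  a complex multiple \<open>a p\<close> of the gradient at \<open>q\<close>. The number
  \<open>c\<close> is \<open>a p\<close> normalised to modulus 1.\<close>

lemma boundary_normals:
  assumes "\<epsilon> > 0"
  shows "\<exists>\<eta>>0. \<forall>p\<in>frontier \<Omega>. dist p q < \<eta> \<longrightarrow>
    (\<exists>k c. cmod c = 1 \<and> cmod (c - 1) < \<epsilon> \<and> (\<forall>z\<in>\<Omega>. Re (cnj c * (A *v (z - p)) $ k) < 0))"
proof -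
  let ?P = "\<lambda>k p. \<exists>c. cmod c = 1 \<and> cmod (c - 1) < \<epsilon> \<and> (\<forall>z\<in>\<Omega>. Re (cnj c * (A *v (z - p)) $ k) < 0)"
  have "\<forall>\<^sub>F p in nhds q. p \<in> frontier \<Omega> \<longrightarrow> f k p = 0 \<longrightarrow> ?P k p" for k
  proof -
    obtain m where m: "G k q $ m \<noteq> 0" using G_q_nonzero[of k] by (auto simp: vec_eq_iff)
    obtain \<eta> where "\<eta> > 0" and \<eta>: "\<And>p i. p \<in> frontier \<Omega> \<Longrightarrow> dist p q < \<eta> \<Longrightarrow> f k p = 0 \<Longrightarrow>
        G k p $ i * G k q $ m = G k q $ i * G k p $ m"
      using gradient_ratio_const[OF m] by blast
    define a where "a = (\<lambda>p. G k p $ m / G k q $ m)"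
    have "isCont (G k) q" using G_cont open_U q_U by (simp add: continuous_on_eq_continuous_at)
    then have "isCont a q" unfolding a_def using m by (intro isCont_divide isCont_vec_nth) auto
    then have "(a \<longlongrightarrow> a q) (nhds q)"
      unfolding isCont_def by (rule iffD1[OF tendsto_at_iff_tendsto_nhds])
    then have "(a \<longlongrightarrow> 1) (nhds q)" using m by (simp add: a_def)
    \<comment> \<open>Normalising moves \<open>a p\<close> by at most its distance to 1, whence the
      half of \<open>\<epsilon>\<close>; the bound 1 keeps \<open>a p\<close> nonzero.\<close>
    moreover have "min (\<epsilon> / 2) 1 > 0" using assms by simp
    ultimately have "\<forall>\<^sub>F p in nhds q. dist (a p) 1 < min (\<epsilon> / 2) 1" by (rule tendstoD)
    moreover have "\<forall>\<^sub>F p in nhds q. dist p q < \<eta>"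
      using \<open>\<eta> > 0\<close> eventually_nhds_metric by blast
    ultimately show ?thesis
    proof eventually_elim
      case (elim p)
      show ?case
      proof (intro impI)
        assume p: "p \<in> frontier \<Omega>" "f k p = 0"
        have close: "cmod (a p - 1) < \<epsilon> / 2" "cmod (a p - 1) < 1" using elim(1) by (auto simp: dist_norm)
        then have "a p \<noteq> 0" by auto
        define c where "c = a p / of_real (cmod (a p))"
        have "cmod c = 1" using \<open>a p \<noteq> 0\<close> by (simp add: c_def norm_divide)
        have a_c: "a p = of_real (cmod (a p)) * c" using \<open>a p \<noteq> 0\<close> by (simp add: c_def)
        have "c - a p = of_real (1 - cmod (a p)) * c" by (subst a_c) (simp add: algebra_simps)
        then have "cmod (c - a p) = \<bar>1 - cmod (a p)\<bar>" using \<open>cmod c = 1\<close> by (simp only: norm_mult norm_of_real mult_1_right)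
        also have "\<dots> \<le> cmod (a p - 1)" using norm_triangle_ineq3[of "a p" 1] by simp
        finally have "cmod (c - 1) < \<epsilon>"
          using norm_triangle_ineq[of "c - a p" "a p - 1"] close(1) by simp
        have G_p: "G k p $ i = a p * G k q $ i" for i
          using \<eta>[OF p(1) elim(2) p(2), of i] m by (simp add: a_def field_simps)
        have "G k p \<noteq> 0" using G_p[of m] m \<open>a p \<noteq> 0\<close> by auto
        have "p \<in> closure \<Omega>" using p(1) by (simp add: frontier_def)
        then have "p \<in> U" using cl_U by blast
        have "Re (cnj c * (A *v (z - p)) $ k) < 0" if "z \<in> \<Omega>" for z
        proof -
          have "(z - p) \<bullet> G k p < 0"
            by (rule convex_gradient_supports[OF convex_\<Omega> open_\<Omega> neg \<open>p \<in> closure \<Omega>\<close> p(2) f_der[OF \<open>p \<in> U\<close>] \<open>G k p \<noteq> 0\<close> that])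
          also have "(z - p) \<bullet> G k p = Re (cnj (a p) * (A *v (z - p)) $ k)"
            unfolding inner_complex_vec A_nth G_p by (simp only: sum_distrib_left complex_cnj_mult mult.left_commute)
          also have "\<dots> = cmod (a p) * Re (cnj c * (A *v (z - p)) $ k)"
            by (subst a_c) (simp add: algebra_simps)
          finally show ?thesis using \<open>a p \<noteq> 0\<close> by (simp add: mult_less_0_iff)
        qed
        then show "?P k p" using \<open>cmod c = 1\<close> \<open>cmod (c - 1) < \<epsilon>\<close> by blast
      qed
    qed
  qed
  then have "\<forall>\<^sub>F p in nhds q. \<forall>k. p \<in> frontier \<Omega> \<longrightarrow> f k p = 0 \<longrightarrow> ?P k p"
    by (rule eventually_all_finite)
  moreover have "\<forall>\<^sub>F p in nhds q. p \<in> ball q e" using e_pos by (intro eventually_nhds_in_open) auto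
  ultimately have "\<forall>\<^sub>F p in nhds q. p \<in> frontier \<Omega> \<longrightarrow> (\<exists>k. ?P k p)"
  proof eventually_elim
    case (elim p)
    show ?case
    proof
      assume p: "p \<in> frontier \<Omega>"
      then have "p \<notin> \<Omega>" using open_\<Omega> by (simp add: frontier_def interior_open)
      then obtain k where "\<not> f k p < 0" using local[OF elim(2)] by blast
      moreover have "f k p \<le> 0" using p f_closure by (simp add: frontier_def)
      ultimately have "f k p = 0" by simp
      then show "\<exists>k. ?P k p" using elim(1) p by blast
    qed
  qed
  then show ?thesis unfolding eventually_nhds_metric by blast
qed

theorem maximal_circularity_corner: "(maximal_circularity \<Omega> \<longlongrightarrow> 1) (at q within \<Omega>)"
proof (rule maximal_circularity_tendsto_1[OF inverse _ open_\<Omega> _ boundary_normals])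
  show "A ** B = mat 1" using inverse matrix_left_right_inverse by blast
  fix z j assume "z \<in> \<Omega>"
  have "q \<in> closure \<Omega>" using q_frontier by (simp add: frontier_def)
  have "(z - q) \<bullet> G j q < 0"
    by (rule convex_gradient_supports[OF convex_\<Omega> open_\<Omega> neg \<open>q \<in> closure \<Omega>\<close> f_q[of j] f_der[OF q_U]
          G_q_nonzero \<open>z \<in> \<Omega>\<close>])
  then show "Re ((A *v (z - q)) $ j) < 0" by (simp only: inner_complex_vec A_nth)
qed

end

section \<open>Reduction to the active defining functions\<close>

lemma independent_family_left_inverse:
  fixes g :: "'n::finite \<Rightarrow> complex ^ 'n"
  assumes "inj g" and indep: "vec.independent (range g)"
  obtains B :: "complex ^ 'n ^ 'n" where "B ** (\<chi> k i. cnj (g k $ i)) = mat 1"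
proof -
  let ?A = "(\<chi> k i. cnj (g k $ i)) :: complex ^ 'n ^ 'n"
  have "c k = 0" if c: "(\<Sum>k\<in>UNIV. c k *s row k ?A) = 0" for c k
  proof -
    \<comment> \<open>Conjugated coefficients turn a relation between the conjugated rows into one
      between the vectors \<open>g k\<close>; \<open>inv g\<close> reindexes it because
      \<open>vec.independent\<close> speaks of a set.\<close>
    define u where "u = (\<lambda>v. cnj (c (inv g v)))"
    have "(\<Sum>k\<in>UNIV. u (g k) *s g k) $ i = cnj ((\<Sum>k\<in>UNIV. c k *s row k ?A) $ i)" for i
      using \<open>inj g\<close> by (simp add: u_def row_def)
    then have "(\<Sum>k\<in>UNIV. u (g k) *s g k) = 0" unfolding c by (simp add: vec_eq_iff)
    then have "(\<Sum>v\<in>range g. u v *s v) = 0" using \<open>inj g\<close> by (simp add: sum.reindex)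
    then have "u (g k) = 0" by (intro vec.independentD[OF indep _ subset_refl]) auto
    then show ?thesis using \<open>inj g\<close> by (simp add: u_def)
  qed
  then obtain B where "?A ** B = mat 1" using matrix_right_invertible_independent_rows by blast
  then show thesis using that matrix_left_right_inverse by blast
qed

theorem theorem3p4:
  fixes \<Omega> :: "(complex ^ 'n::finite) set"
    and \<rho> :: "nat \<Rightarrow> complex ^ 'n \<Rightarrow> real"
    and N :: nat
    and \<alpha> :: "'n \<Rightarrow> nat"
    and q :: "complex ^ 'n"
  assumes "normal_polyhedral_domain N \<rho> \<Omega>"
    and "convex \<Omega>"
    and "inj \<alpha>" and "range \<alpha> \<subseteq> {1..N}"
    and "q \<in> face \<rho> \<Omega> (range \<alpha>)"
  shows "(maximal_circularity \<Omega> \<longlongrightarrow> 1) (at q within \<Omega>)"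
proof -
  have poly: "polyhedral_domain N \<rho> \<Omega>"
    and normal: "\<And>A z. A \<noteq> {} \<Longrightarrow> A \<subseteq> {1..N} \<Longrightarrow> z \<in> face \<rho> \<Omega> A \<Longrightarrow>
      inj_on (\<lambda>\<alpha>. gradient (\<rho> \<alpha>) z) A \<and> vec.independent ((\<lambda>\<alpha>. gradient (\<rho> \<alpha>) z) ` A)"
    using assms(1) unfolding normal_polyhedral_domain_def by blast+
  have "open \<Omega>" using poly by (simp add: polyhedral_domain_def)
  obtain U where U: "open U" "closure \<Omega> \<subseteq> U" and smooth: "\<And>\<beta>. \<beta> \<in> {1..N} \<Longrightarrow> smooth_on (\<rho> \<beta>) U"
    and \<Omega>: "\<Omega> = {z \<in> U. \<forall>\<beta>\<in>{1..N}. \<rho> \<beta> z < 0}"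
    using poly unfolding polyhedral_domain_def by blast
  have flat: "levi_flat (\<rho> \<beta>) (face \<rho> \<Omega> {\<beta>})" if "\<beta> \<in> {1..N}" for \<beta>
    using poly that by (simp add: polyhedral_domain_def)
  have q: "q \<in> frontier \<Omega>" "\<And>k. \<rho> (\<alpha> k) q = 0" using assms(5) by (auto simp: face_def)
  have "q \<in> closure \<Omega>" using q(1) by (simp add: frontier_def)
  then have "q \<in> U" using U(2) by blast
  have cont: "continuous_on U (\<rho> \<beta>)" if "\<beta> \<in> {1..N}" for \<beta>
    by (rule has_derivative_continuous_on)
      (use smooth_on_has_derivative[OF smooth[OF that] U(1)] has_derivative_at_withinI in blast)
  let ?g = "\<lambda>k. gradient (\<rho> (\<alpha> k)) q"
  have indep: "inj_on (\<lambda>\<alpha>. gradient (\<rho> \<alpha>) q) (range \<alpha>) \<and> vec.independent ((\<lambda>\<alpha>. gradient (\<rho> \<alpha>) q) ` range \<alpha>)"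
    using normal[OF _ assms(4,5)] by blast
  then have "inj ((\<lambda>\<alpha>. gradient (\<rho> \<alpha>) q) \<circ> \<alpha>)" by (intro comp_inj_on[OF \<open>inj \<alpha>\<close>]) blast
  then have "inj ?g" by (simp add: comp_def)
  moreover have "vec.independent (range ?g)" using indep by (simp add: image_image)
  ultimately obtain B :: "complex ^ 'n ^ 'n" where B: "B ** (\<chi> k i. cnj (?g k $ i)) = mat 1"
    by (rule independent_family_left_inverse)
  \<comment> \<open>A further function vanishing at \<open>q\<close> would give more than
    \<open>CARD('n)\<close> independent gradients in a space of that complex dimension.\<close>
  have inactive: "\<rho> \<beta> q < 0" if \<beta>: "\<beta> \<in> {1..N}" "\<beta> \<notin> range \<alpha>" for \<beta>
  proof -
    have "\<rho> \<beta> q \<noteq> 0"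
    proof
      assume "\<rho> \<beta> q = 0"
      let ?A = "insert \<beta> (range \<alpha>)"
      have "q \<in> face \<rho> \<Omega> ?A" using assms(5) \<open>\<rho> \<beta> q = 0\<close> by (simp add: face_def)
      then have "inj_on (\<lambda>\<alpha>. gradient (\<rho> \<alpha>) q) ?A" "vec.independent ((\<lambda>\<alpha>. gradient (\<rho> \<alpha>) q) ` ?A)"
        using normal[of ?A q] assms(4) \<beta>(1) by auto
      then have "card ?A \<le> vec.dim (UNIV :: (complex ^ 'n) set)"
        by (metis card_image vec.independent_card_le_dim subset_UNIV)
      moreover have "card ?A = Suc CARD('n)" using \<beta>(2) \<open>inj \<alpha>\<close> by (simp add: card_image)
      ultimately show False unfolding vec_dim_card by simp
    qed
    moreover have "\<rho> \<beta> q \<le> 0"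
    proof (rule continuous_le_on_closure[OF continuous_on_subset[OF cont[OF \<beta>(1)] U(2)] \<open>q \<in> closure \<Omega>\<close>])
      show "\<rho> \<beta> z \<le> 0" if "z \<in> \<Omega>" for z
        using that \<beta>(1) unfolding \<Omega> by (auto intro: less_imp_le)
    qed
    ultimately show ?thesis by simp
  qed
  have "\<forall>\<^sub>F z in nhds q. \<forall>\<beta>\<in>{1..N} - range \<alpha>. \<rho> \<beta> z < 0"
  proof (intro eventually_ball_finite ballI)
    fix \<beta> assume \<beta>: "\<beta> \<in> {1..N} - range \<alpha>"
    then have "isCont (\<rho> \<beta>) q" using cont U(1) \<open>q \<in> U\<close> by (simp add: continuous_on_eq_continuous_at)
    then have "(\<rho> \<beta> \<longlongrightarrow> \<rho> \<beta> q) (nhds q)"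
      unfolding isCont_def by (rule iffD1[OF tendsto_at_iff_tendsto_nhds])
    then show "\<forall>\<^sub>F z in nhds q. \<rho> \<beta> z < 0" by (rule order_tendstoD) (use inactive \<beta> in blast)
  qed simp
  moreover have "\<forall>\<^sub>F z in nhds q. z \<in> U" using U(1) \<open>q \<in> U\<close> by (rule eventually_nhds_in_open)
  ultimately have "\<forall>\<^sub>F z in nhds q. (\<forall>\<beta>\<in>{1..N} - range \<alpha>. \<rho> \<beta> z < 0) \<and> z \<in> U"
    by (rule eventually_conj)
  \<comment> \<open>On this ball the inactive inequalities hold automatically, which yields the
    assumption \<open>local\<close> of the locale.\<close>
  then obtain e where "e > 0" and e: "\<And>z. dist z q < e \<Longrightarrow> (\<forall>\<beta>\<in>{1..N} - range \<alpha>. \<rho> \<beta> z < 0) \<and> z \<in> U"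
    unfolding eventually_nhds_metric by blast
  have \<alpha>: "\<alpha> k \<in> {1..N}" for k using assms(4) by blast
  interpret levi_flat_corner \<Omega> U "\<lambda>k. \<rho> (\<alpha> k)" q e B
  proof
    show "ball q e \<subseteq> U" using e by (auto simp: dist_commute)
    show "\<rho> (\<alpha> k) z < 0" if "z \<in> \<Omega>" for z k using that \<alpha>[of k] unfolding \<Omega> by blast
    show "z \<in> \<Omega>" if "z \<in> ball q e" "\<And>k. \<rho> (\<alpha> k) z < 0" for z
    proof -
      have "(\<forall>\<beta>\<in>{1..N} - range \<alpha>. \<rho> \<beta> z < 0) \<and> z \<in> U" using e that(1) by (simp add: dist_commute)
      then show ?thesis using that(2) unfolding \<Omega> by blast
    qed
    show "levi_flat (\<rho> (\<alpha> k)) {z \<in> frontier \<Omega>. \<rho> (\<alpha> k) z = 0}" for k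
      using flat[OF \<alpha>[of k]] by (simp add: face_def)
  qed (fact \<open>open \<Omega>\<close> assms(2) U smooth[OF \<alpha>] \<open>e > 0\<close> q B)+
  show ?thesis by (rule maximal_circularity_corner)
qed

end
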